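(* Let $\mathcal{N}\subseteq\mathbb{V}^{m\times n}$ be a nonempty open set, let $g:\mathbb{R}^m\to\mathbb{R}^m$ be absolutely symmetric on an open set $\hat\sigma_{\mathcal{N}}\subseteq\mathbb{R}^m$ containing $\{\sigma(X)\mid X\in\mathcal{N}\}$, and let $G:\mathcal{N}\to\mathbb{V}^{m\times n}$ be the spectral operator with respect to $g$. Let $\overline{X}\in\mathcal{N}$. Then $G$ is locally Lipschitz continuous near $\overline{X}$ if and only if $g$ is locally Lipschitz continuous near $\overline\sigma=\sigma(\overline{X})$.
   Context: Fix $m\le n$. $\mathbb{V}^{m\times n}$ denotes either $\mathbb{R}^{m\times n}$ or $\mathbb{C}^{m\times n}$, viewed as a real Euclidean space with inner product $\langle X,Y\rangle=\mathrm{Re}(\mathrm{trace}(X^{*}Y))$ and induced norm, where $X^{*}$ is the (conjugate) transpose. $\mathbb{O}^p$ is the set of $p\times p$ orthogonal (real case) or unitary (complex case) matrices. $\sigma(Z)\in\mathbb{R}^m$ is the vector of singular values $\sigma_1(Z)\ge\cdots\ge\sigma_m(Z)\ge0$ of $Z\in\mathbb{V}^{m\times n}$; $\mathrm{Diag}(x)$ is the diagonal matrix with diagonal $x$; $\mathbb{O}^{m,n}(Z)$ is the set of pairs $(U,V)\in\mathbb{O}^m\times\mathbb{O}^n$ with $Z=U[\mathrm{Diag}(\sigma(Z))\quad 0]V^{*}$. A signed permutation matrix is a square matrix with exactly one nonzero entry in each row and each column, that entry being $\pm1$. The mapping $g:\mathbb{R}^m\to\mathbb{R}^m$ is absolutely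 symmetric on a set $D$ if $g(Qx)=Qg(x)$ for every $x\in D$ and every $m\times m$ signed permutation matrix $Q$. The spectral operator $G$ with respect to $g$ is $G(X)=U[\mathrm{Diag}(g(\sigma(X)))\quad 0]V^{*}$ for $X\in\mathcal{N}$, where $(U,V)\in\mathbb{O}^{m,n}(X)$ (the value does not depend on the choice of $(U,V)$). A function is locally Lipschitz continuous near a point if it is Lipschitz continuous on some neighborhood of that point. *)

theory Defs
  imports "HOL-Analysis.Analysis" "Jordan_Normal_Form.Conjugate"
begin

type_synonym ('a, 'm, 'n) matrix = "(('a, 'n) vec, 'm) vec"

text \<open>
  An m by n matrix over \<open>'a\<close> has type \<open>'a ^ 'n ^ 'm = ('a, 'm, 'n) matrix\<close>, with \<open>'a\<close> instantiated by \<open>real\<close> or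
  \<open>complex\<close>; \<open>conjugate\<close> is the identity on \<open>real\<close> and \<open>cnj\<close> on \<open>complex\<close>. The norm, distance and
  topology of these types are the ones induced by the inner product Re (trace (X* Y)); see the
  lemmas \<open>inner_matrix_real\<close> and \<open>inner_matrix_complex\<close>.
\<close>

definition ctranspose :: "'a::conjugate ^ 'n ^ 'm \<Rightarrow> 'a ^ 'm ^ 'n" where
  "ctranspose A = (\<chi> i j. conjugate (A $ j $ i))"

lemma inner_matrix_real:
  fixes X Y :: "real ^ 'n ^ 'm"
  shows "inner X Y = trace (ctranspose X ** Y)"
  unfolding inner_vec_def trace_def matrix_matrix_mult_def ctranspose_def
  by (simp, subst sum.swap, simp)

lemma inner_matrix_complex:
  fixes X Y :: "complex ^ 'n ^ 'm"
  shows "inner X Y = Re (trace (ctranspose X ** Y))"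
  unfolding inner_vec_def trace_def matrix_matrix_mult_def ctranspose_def
  by (simp add: inner_complex_def, subst sum.swap, simp)

definition unitary_matrix :: "'a::{semiring_1,conjugate} ^ 'n ^ 'n \<Rightarrow> bool" where
  "unitary_matrix U \<longleftrightarrow> ctranspose U ** U = mat 1 \<and> U ** ctranspose U = mat 1"

lemma unitary_matrix_real: "unitary_matrix (U :: real ^ 'n ^ 'n) \<longleftrightarrow> orthogonal_matrix U"
  by (simp add: unitary_matrix_def orthogonal_matrix_def ctranspose_def transpose_def)

text \<open>
  The index types carry a linear order, and \<open>idx_pos\<close> is the (zero-based) position of an index
  in that order. It identifies the rows with the first \<open>CARD('m)\<close> columns, so that
  \<open>diag_rect x\<close> is the block matrix [Diag(x) 0].
\<close>

definition idx_pos :: "'i::{finite,linorder} \<Rightarrow> nat" where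
  "idx_pos i = card {k. k < i}"

definition diag_rect ::
    "(real, 'm::{finite,linorder}) vec \<Rightarrow> ('a::real_algebra_1, 'm, 'n::{finite,linorder}) matrix" where
  "diag_rect x = (\<chi> i j. if idx_pos i = idx_pos j then of_real (x $ i) else 0)"

text \<open>
  The vector of singular values is the nonincreasing nonnegative diagonal occurring in a singular
  value decomposition; for \<open>CARD('m) \<le> CARD('n)\<close> over the reals or the complex numbers it exists
  and is unique.
\<close>

definition singular_values ::
    "('a::{real_algebra_1,conjugate}, 'm::{finite,linorder}, 'n::{finite,linorder}) matrix \<Rightarrow> (real, 'm) vec" where
  "singular_values Z = (THE s.
     (\<forall>i j. i \<le> j \<longrightarrow> s $ j \<le> s $ i) \<and> (\<forall>i. 0 \<le> s $ i) \<and>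
     (\<exists>U V. unitary_matrix U \<and> unitary_matrix V \<and> Z = U ** diag_rect s ** ctranspose V))"

definition svd_pairs ::
    "('a::{real_algebra_1,conjugate}, 'm::{finite,linorder}, 'n::{finite,linorder}) matrix
      \<Rightarrow> (('a, 'm, 'm) matrix \<times> ('a, 'n, 'n) matrix) set" where
  "svd_pairs Z = {(U, V). unitary_matrix U \<and> unitary_matrix V \<and>
     Z = U ** diag_rect (singular_values Z) ** ctranspose V}"

definition signed_permutation_matrix :: "real ^ 'm ^ 'm \<Rightarrow> bool" where
  "signed_permutation_matrix Q \<longleftrightarrow>
     (\<forall>i. \<exists>!j. Q $ i $ j \<noteq> 0) \<and> (\<forall>j. \<exists>!i. Q $ i $ j \<noteq> 0) \<and>
     (\<forall>i j. Q $ i $ j \<noteq> 0 \<longrightarrow> Q $ i $ j = 1 \<or> Q $ i $ j = -1)"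

definition absolutely_symmetric_on :: "(real ^ 'm) set \<Rightarrow> (real ^ 'm \<Rightarrow> real ^ 'm) \<Rightarrow> bool" where
  "absolutely_symmetric_on D g \<longleftrightarrow>
     (\<forall>x\<in>D. \<forall>Q. signed_permutation_matrix Q \<longrightarrow> g (Q *v x) = Q *v g x)"

text \<open>
  When \<open>g\<close> is absolutely symmetric on a set containing \<open>singular_values X\<close>, the value of the
  spectral operator at \<open>X\<close> does not depend on the chosen pair.
\<close>

definition spectral_operator ::
    "((real, 'm::{finite,linorder}) vec \<Rightarrow> (real, 'm) vec)
      \<Rightarrow> ('a::{real_algebra_1,conjugate}, 'm, 'n::{finite,linorder}) matrix \<Rightarrow> ('a, 'm, 'n) matrix" where
  "spectral_operator g X =
     (let (U, V) = (SOME p. p \<in> svd_pairs X)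
      in U ** diag_rect (g (singular_values X)) ** ctranspose V)"

text \<open>For a function with domain \<open>S\<close>; the neighbourhood has to lie in the domain.\<close>

definition locally_lipschitz_near ::
    "'a::metric_space set \<Rightarrow> ('a \<Rightarrow> 'b::metric_space) \<Rightarrow> 'a \<Rightarrow> bool" where
  "locally_lipschitz_near S f x \<longleftrightarrow>
     (\<exists>W L. open W \<and> x \<in> W \<and> W \<subseteq> S \<and> L-lipschitz_on W f)"

end

theory Submission
  imports Defs
begin

text \<open>
  Write \<open>X = U [Diag a 0] V*\<close> and \<open>Y = U' [Diag b 0] V'*\<close>. Everything rests on one identity,

    \<open>|X - Y|\<^sup>2 = \<Sum>i j. p i j * (a i - b j)\<^sup>2 + q i j * (a i + b j)\<^sup>2
              + \<Sum>i. r i * (a i)\<^sup>2 + \<Sum>j. s j * (b j)\<^sup>2\<close>,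

  in which the nonnegative weights depend on the unitary factors only, not on the diagonals
  (\<open>obtain_svd_coupling\<close>). The weights \<open>p\<close> and \<open>q\<close> are the squared moduli of \<open>(Z i j \<plusminus> W i j) / 2\<close> for
  the relative rotations \<open>W = U* U'\<close> and \<open>Z = V* V'\<close>. The identity therefore holds with the same weights for the images
  of \<open>X\<close> and \<open>Y\<close> under the spectral operator, with \<open>g a\<close> and \<open>g b\<close> in place of \<open>a\<close> and \<open>b\<close>.

  If \<open>g\<close> is Lipschitz near \<open>\<sigma>\<close>, then for \<open>a\<close> and \<open>b\<close> near \<open>\<sigma>\<close> and each sign, \<open>g a i \<plusminus> g b j\<close> is
  bounded by a multiple of \<open>|a - b| + |a i \<plusminus> b j|\<close> (\<open>locally_lipschitz_coords\<close>): either the signed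
  swap of the two coordinates fixes \<open>\<sigma>\<close>, and then absolute symmetry turns the Lipschitz bound into
  one for coordinates, or \<open>a i \<plusminus> b j\<close> stays away from zero. Comparing the two instances of the
  identity term by term bounds the distance of the images by the distances of \<open>X\<close> and \<open>Y\<close> and of
  \<open>a\<close> and \<open>b\<close> (\<open>transfer_le\<close>).

  The distance of \<open>a\<close> and \<open>b\<close> is controlled by the same identity. The weights dominate half of a
  doubly stochastic matrix, and for sorted diagonals a mass count gives
  \<open>(a k - b k)\<^sup>2 \<le> 2 |X - Y|\<^sup>2\<close> (\<open>svd_sorted_diff_le\<close>). This is at once the uniqueness and the
  Lipschitz continuity of singular values. The case of distance zero shows also that the spectral
  operator does not depend on the decomposition (\<open>transfer_eq_0\<close>), and may be evaluated on unsorted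
  diagonals (\<open>spectral_operator_diag\<close>). The converse implication follows, because \<open>g\<close> is then the
  restriction of the operator to an isometric copy of a neighbourhood of \<open>\<sigma>\<close>.

  Existence of decompositions comes from maximising a linear functional over pairs of unitary
  matrices (\<open>svd_exists_unsorted\<close>). Real and complex matrices are treated together, as matrices over
  a class of scalars that has both fields as instances.
\<close>

section \<open>Scalars\<close>

text \<open>
  The common ground of the real and the complex numbers on which the whole argument runs. The one
  axiom makes conjugation the adjoint of multiplication for the real inner product; that conjugation
  fixes the reals and is isometric follows from it.
\<close>
class hermitian_field = real_normed_field + euclidean_space + conjugatable_field +
  assumes conjugate_mult_self_scaleR: "conjugate x * x = (norm x)\<^sup>2 *\<^sub>R 1"

instance real :: hermitian_field
  by standard (simp add: power2_eq_square)

instance complex :: hermitian_field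
  by standard (simp add: scaleR_conv_of_real complex_norm_square mult.commute del: of_real_power)

lemma conjugate_mult_self:
  "conjugate x * x = (of_real ((norm x)\<^sup>2) :: 'a::hermitian_field)"
  by (simp add: conjugate_mult_self_scaleR of_real_def)

lemma conjugate_of_real [simp]: "conjugate (of_real r :: 'a::hermitian_field) = of_real r"
proof (cases "r = 0")
  case False
  have "conjugate (of_real r :: 'a) * of_real r = of_real r * of_real r"
    using conjugate_mult_self[of "of_real r :: 'a"] by (simp add: power2_eq_square)
  then show ?thesis using False by simp
qed simp

lemma conjugate_one [simp]: "conjugate (1 :: 'a::hermitian_field) = 1"
  using conjugate_of_real[of 1, where 'a='a] by (simp del: conjugate_of_real)

lemma norm_conjugate [simp]: "norm (conjugate x :: 'a::hermitian_field) = norm x"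
proof (cases "x = 0")
  case False
  have "norm (conjugate x) * norm x = norm x * norm x"
    using arg_cong[OF conjugate_mult_self[of x], of norm] by (simp add: norm_mult power2_eq_square)
  then show ?thesis using False by simp
qed simp

text \<open>
  Polarisation of the class axiom; it reduces identities about the inner product to ring identities.
\<close>
lemma of_real_inner_eq:
  fixes x y :: "'a::hermitian_field"
  shows "of_real (2 * inner x y) = conjugate x * y + conjugate y * x"
proof -
  have "2 * inner x y = (norm (x + y))\<^sup>2 - (norm x)\<^sup>2 - (norm y)\<^sup>2"
    by (simp add: dot_norm)
  then have "of_real (2 * inner x y) = (of_real ((norm (x + y))\<^sup>2) - of_real ((norm x)\<^sup>2) - of_real ((norm y)\<^sup>2) :: 'a)"
    by (metis of_real_diff)
  also have "\<dots> = conjugate x * y + conjugate y * x"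
    unfolding conjugate_mult_self[symmetric] by (simp add: conjugate_dist_add algebra_simps)
  finally show ?thesis .
qed

lemma inner_mult_conjugate_left:
  fixes a b c :: "'a::hermitian_field"
  shows "inner (a * b) c = inner b (conjugate a * c)"
proof -
  have "(of_real (2 * inner (a * b) c) :: 'a) = of_real (2 * inner b (conjugate a * c))"
    unfolding of_real_inner_eq by (simp add: conjugate_dist_mul algebra_simps)
  then show ?thesis by (simp only: of_real_eq_iff)
qed

lemma inner_conjugate_conjugate:
  "inner (conjugate x) (conjugate y) = inner x (y :: 'a::hermitian_field)"
proof -
  have "(of_real (2 * inner (conjugate x) (conjugate y)) :: 'a) = of_real (2 * inner x y)"
    unfolding of_real_inner_eq by (simp add: algebra_simps)
  then show ?thesis by (simp only: of_real_eq_iff)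
qed

lemma continuous_on_conjugate [continuous_intros]:
  fixes f :: "'b::topological_space \<Rightarrow> 'a::hermitian_field"
  assumes "continuous_on S f"
  shows "continuous_on S (\<lambda>x. conjugate (f x))"
proof -
  have "dist (conjugate x) (conjugate y) = dist x y" for x y :: 'a
    unfolding dist_norm
    using norm_conjugate[of "x - y"] conjugate_dist_add[of x "- y"]
    by (metis conjugate_neg uminus_add_conv_diff add.commute)
  then have "continuous_on UNIV (conjugate :: 'a \<Rightarrow> 'a)"
    unfolding continuous_on_iff by metis
  then show ?thesis
    using assms by (rule continuous_on_compose2) auto
qed

section \<open>Conjugate transposes and unitary matrices\<close>

lemma ctranspose_ctranspose [simp]: "ctranspose (ctranspose A) = A"
  by (simp add: ctranspose_def)

lemma ctranspose_matrix_mult: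
  fixes A :: "'a::hermitian_field ^ 'n ^ 'm" and B :: "'a ^ 'k ^ 'n"
  shows "ctranspose (A ** B) = ctranspose B ** ctranspose A"
  by (simp add: ctranspose_def matrix_matrix_mult_def vec_eq_iff sum_conjugate
      conjugate_dist_mul mult.commute)

lemma inner_matrix_mult_left:
  fixes A :: "'a::hermitian_field ^ 'n ^ 'm" and B :: "'a ^ 'k ^ 'n" and C :: "'a ^ 'k ^ 'm"
  shows "inner (A ** B) C = inner B (ctranspose A ** C)"
proof -
  have "inner (A ** B) C = (\<Sum>i\<in>UNIV. \<Sum>l\<in>UNIV. \<Sum>j\<in>UNIV. inner (B $ j $ l) (conjugate (A $ i $ j) * C $ i $ l))"
    by (simp add: inner_vec_def matrix_matrix_mult_def inner_sum_left inner_mult_conjugate_left)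
  also have "\<dots> = (\<Sum>j\<in>UNIV. \<Sum>l\<in>UNIV. \<Sum>i\<in>UNIV. inner (B $ j $ l) (conjugate (A $ i $ j) * C $ i $ l))"
    by (subst sum.swap, subst (2) sum.swap, subst sum.swap) simp
  also have "\<dots> = inner B (ctranspose A ** C)"
    by (simp add: inner_vec_def matrix_matrix_mult_def ctranspose_def inner_sum_right)
  finally show ?thesis .
qed

lemma inner_ctranspose_ctranspose:
  fixes A B :: "'a::hermitian_field ^ 'n ^ 'm"
  shows "inner (ctranspose A) (ctranspose B) = inner A B"
  unfolding inner_vec_def ctranspose_def
  by (simp add: inner_conjugate_conjugate, subst sum.swap, simp)

lemma inner_matrix_mult_right:
  fixes A :: "'a::hermitian_field ^ 'n ^ 'm" and B :: "'a ^ 'k ^ 'n" and C :: "'a ^ 'k ^ 'm"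
  shows "inner (A ** B) C = inner A (C ** ctranspose B)"
  using inner_matrix_mult_left[of "ctranspose B" "ctranspose A" "ctranspose C"]
  by (metis ctranspose_ctranspose ctranspose_matrix_mult inner_ctranspose_ctranspose)

lemma matrix_mult_diff_right:
  fixes A :: "'a::ring_1 ^ 'n ^ 'm" and B C :: "'a ^ 'k ^ 'n"
  shows "A ** (B - C) = A ** B - A ** C"
  by (simp add: matrix_matrix_mult_def vec_eq_iff right_diff_distrib sum_subtractf)

lemma matrix_mult_diff_left:
  fixes A B :: "'a::ring_1 ^ 'n ^ 'm" and C :: "'a ^ 'k ^ 'n"
  shows "(A - B) ** C = A ** C - B ** C"
  by (simp add: matrix_matrix_mult_def vec_eq_iff left_diff_distrib sum_subtractf)

text \<open>
  For square matrices over a field a one-sided inverse is two-sided.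
\<close>
lemma unitary_matrixI:
  fixes U :: "'a::hermitian_field ^ 'n ^ 'n"
  assumes "ctranspose U ** U = mat 1"
  shows "unitary_matrix U"
  using assms matrix_left_right_inverse unitary_matrix_def by blast

lemma unitary_matrix_mat_1: "unitary_matrix (mat 1 :: 'a::hermitian_field ^ 'p ^ 'p)"
proof -
  have "ctranspose (mat 1 :: 'a ^ 'p ^ 'p) = mat 1"
    by (auto simp: vec_eq_iff ctranspose_def mat_def)
  then show ?thesis by (simp add: unitary_matrix_def)
qed

lemma unitary_matrix_mult:
  fixes U V :: "'a::hermitian_field ^ 'n ^ 'n"
  assumes "unitary_matrix U" "unitary_matrix V"
  shows "unitary_matrix (U ** V)"
proof (rule unitary_matrixI)
  have "ctranspose (U ** V) ** (U ** V) = ctranspose V ** (ctranspose U ** U) ** V"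
    by (simp add: ctranspose_matrix_mult matrix_mul_assoc)
  then show "ctranspose (U ** V) ** (U ** V) = mat 1"
    using assms by (simp add: unitary_matrix_def)
qed

lemma unitary_matrix_ctranspose:
  fixes U :: "'a::hermitian_field ^ 'n ^ 'n"
  assumes "unitary_matrix U"
  shows "unitary_matrix (ctranspose U)"
  using assms by (simp add: unitary_matrix_def)

lemma unitary_matrix_row_sum:
  fixes U :: "'a::hermitian_field ^ 'n ^ 'n"
  assumes "unitary_matrix U"
  shows "(\<Sum>j\<in>UNIV. (norm (U $ i $ j))\<^sup>2) = 1"
proof -
  have "(\<Sum>j\<in>UNIV. conjugate (U $ i $ j) * U $ i $ j) = (U ** ctranspose U) $ i $ i"
    by (simp add: matrix_matrix_mult_def ctranspose_def mult.commute)
  also have "\<dots> = 1" using assms by (simp add: unitary_matrix_def mat_def)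
  finally have "of_real (\<Sum>j\<in>UNIV. (norm (U $ i $ j))\<^sup>2) = (1 :: 'a)"
    by (simp add: conjugate_mult_self)
  then show ?thesis by (metis of_real_eq_1_iff)
qed

lemma unitary_matrix_col_sum:
  fixes U :: "'a::hermitian_field ^ 'n ^ 'n"
  assumes "unitary_matrix U"
  shows "(\<Sum>i\<in>UNIV. (norm (U $ i $ j))\<^sup>2) = 1"
  using unitary_matrix_row_sum[OF unitary_matrix_ctranspose[OF assms], of j]
  by (simp add: ctranspose_def)

lemma inner_unitary_matrix:
  fixes U :: "'a::hermitian_field ^ 'm ^ 'm" and V :: "'a ^ 'n ^ 'n"
    and A B :: "'a ^ 'n ^ 'm"
  assumes "unitary_matrix U" "unitary_matrix V"
  shows "inner (U ** A ** ctranspose V) (U ** B ** ctranspose V) = inner A B"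
proof -
  have "ctranspose U ** (U ** B ** ctranspose V) ** V = (ctranspose U ** U) ** B ** (ctranspose V ** V)"
    by (simp add: matrix_mul_assoc)
  also have "\<dots> = B" using assms by (simp add: unitary_matrix_def)
  finally have *: "ctranspose U ** (U ** B ** ctranspose V) ** V = B" .
  have "inner (U ** A ** ctranspose V) (U ** B ** ctranspose V)
      = inner (U ** A) (U ** B ** ctranspose V ** V)"
    by (subst inner_matrix_mult_right) simp
  also have "\<dots> = inner A (ctranspose U ** (U ** B ** ctranspose V) ** V)"
    by (subst inner_matrix_mult_left) (simp add: matrix_mul_assoc)
  finally show ?thesis unfolding * .
qed



lemma norm_vec_power2: "(norm (a :: real ^ 'n))\<^sup>2 = (\<Sum>i\<in>UNIV. (a $ i)\<^sup>2)"
  by (simp add: norm_vec_def L2_set_def sum_nonneg)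

lemma norm_unitary_matrix:
  fixes U :: "'a::hermitian_field ^ 'm ^ 'm" and V :: "'a ^ 'n ^ 'n" and A :: "'a ^ 'n ^ 'm"
  assumes "unitary_matrix U" "unitary_matrix V"
  shows "norm (U ** A ** ctranspose V) = norm A"
  by (simp add: norm_eq_sqrt_inner inner_unitary_matrix[OF assms])

section \<open>Rectangular diagonal matrices\<close>

lemma idx_pos_less: "i < j \<Longrightarrow> idx_pos i < idx_pos (j :: 'i::{finite,linorder})"
  unfolding idx_pos_def by (rule psubset_card_mono) auto

lemma idx_pos_eq_iff: "idx_pos i = idx_pos j \<longleftrightarrow> i = (j :: 'i::{finite,linorder})"
  by (metis idx_pos_less less_irrefl linorder_neqE)

lemma range_idx_pos: "range (idx_pos :: 'i::{finite,linorder} \<Rightarrow> nat) = {..<CARD('i)}"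
proof (rule card_subset_eq)
  show "range (idx_pos :: 'i \<Rightarrow> nat) \<subseteq> {..<CARD('i)}"
    unfolding idx_pos_def by (auto intro!: psubset_card_mono)
  show "card (range (idx_pos :: 'i \<Rightarrow> nat)) = card {..<CARD('i)}"
    by (simp add: card_image inj_on_def idx_pos_eq_iff)
qed simp

text \<open>
  The embedding of the row indices as the first column indices. The choice is well-defined when
  there are at least as many columns as rows, by \<open>range_idx_pos\<close>.
\<close>
definition col_of :: "'m::{finite,linorder} \<Rightarrow> 'n::{finite,linorder}" where
  "col_of i = (SOME j. idx_pos j = idx_pos i)"

lemma idx_pos_col_of:
  assumes "CARD('m::{finite,linorder}) \<le> CARD('n::{finite,linorder})"
  shows "idx_pos (col_of (i :: 'm) :: 'n) = idx_pos i"
proof -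
  have "idx_pos i < CARD('m)"
    using range_idx_pos[where 'i='m] by blast
  then have "idx_pos i \<in> range (idx_pos :: 'n \<Rightarrow> nat)"
    using assms by (simp add: range_idx_pos)
  then show ?thesis unfolding col_of_def by (metis (mono_tags, lifting) imageE someI)
qed

lemma idx_pos_eq_col_of:
  assumes "CARD('m::{finite,linorder}) \<le> CARD('n::{finite,linorder})"
  shows "idx_pos (i :: 'm) = idx_pos (j :: 'n) \<longleftrightarrow> j = col_of i"
  by (metis assms idx_pos_col_of idx_pos_eq_iff)

lemma col_of_eq_iff:
  assumes "CARD('m::{finite,linorder}) \<le> CARD('n::{finite,linorder})"
  shows "(col_of (i :: 'm) :: 'n) = col_of j \<longleftrightarrow> i = j"
  by (metis assms idx_pos_col_of idx_pos_eq_iff)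

lemma diag_rect_nth:
  assumes "CARD('m::{finite,linorder}) \<le> CARD('n::{finite,linorder})"
  shows "(diag_rect x :: ('a::real_algebra_1, 'm, 'n) matrix) $ i $ j =
    (if j = col_of i then of_real (x $ i) else 0)"
  by (simp add: diag_rect_def idx_pos_eq_col_of[OF assms])

lemma inner_diag_rect:
  fixes M :: "('a::hermitian_field, 'm::{finite,linorder}, 'n::{finite,linorder}) matrix"
  assumes "CARD('m) \<le> CARD('n)"
  shows "inner (diag_rect x) M = (\<Sum>i\<in>UNIV. x $ i * inner 1 (M $ i $ col_of i))"
proof -
  have "inner (diag_rect x) M = (\<Sum>i\<in>UNIV. \<Sum>j\<in>UNIV. if j = col_of i then inner (of_real (x $ i)) (M $ i $ j) else 0)"
    unfolding inner_vec_def diag_rect_nth[OF assms] by (intro sum.cong refl) auto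
  then show ?thesis by (simp add: of_real_def)
qed

lemma diag_rect_diff:
  "diag_rect x - diag_rect y = (diag_rect (x - y) :: ('a::real_algebra_1, 'm::{finite,linorder}, 'n::{finite,linorder}) matrix)"
  by (simp add: diag_rect_def vec_eq_iff)

lemma norm_diag_rect:
  assumes "CARD('m::{finite,linorder}) \<le> CARD('n::{finite,linorder})"
  shows "norm (diag_rect x :: ('a::hermitian_field, 'm, 'n) matrix) = norm x"
  unfolding norm_eq_sqrt_inner inner_diag_rect[OF assms]
  by (simp add: diag_rect_nth[OF assms] inner_vec_def of_real_def dot_square_norm)

section \<open>The distance of two matrices through their decompositions\<close>

text \<open>
  Both factor pairs enter the inner product only through the relative rotations
  \<open>U* U'\<close> and \<open>V* V'\<close>, and bilinearly in the two diagonals.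
\<close>
lemma inner_rect_svd:
  fixes U U' :: "('a::hermitian_field, 'm::{finite,linorder}, 'm) matrix"
    and V V' :: "('a, 'n::{finite,linorder}, 'n) matrix"
  assumes mn: "CARD('m) \<le> CARD('n)"
  defines "W \<equiv> ctranspose U ** U'" and "Z \<equiv> ctranspose V ** V'"
  shows "inner (U ** diag_rect a ** ctranspose V) (U' ** diag_rect b ** ctranspose V')
    = (\<Sum>i\<in>UNIV. \<Sum>j\<in>UNIV. a $ i * b $ j * inner (Z $ col_of i $ col_of j) (W $ i $ j))"
proof -
  have "inner (U ** diag_rect a ** ctranspose V) (U' ** diag_rect b ** ctranspose V')
      = inner (diag_rect a) (ctranspose U ** (U' ** diag_rect b ** ctranspose V') ** V)"
    by (subst inner_matrix_mult_right, subst inner_matrix_mult_left) (simp add: matrix_mul_assoc)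
  also have "ctranspose U ** (U' ** diag_rect b ** ctranspose V') ** V = W ** diag_rect b ** ctranspose Z"
    by (simp add: W_def Z_def ctranspose_matrix_mult matrix_mul_assoc)
  also have "inner (diag_rect a) (W ** diag_rect b ** ctranspose Z)
      = (\<Sum>i\<in>UNIV. a $ i * (\<Sum>j\<in>UNIV. b $ j * inner (Z $ col_of i $ col_of j) (W $ i $ j)))"
  proof -
    have entry: "(W ** diag_rect b ** ctranspose Z) $ i $ col_of i
        = (\<Sum>j\<in>UNIV. b $ j *\<^sub>R (conjugate (Z $ col_of i $ col_of j) * W $ i $ j))" for i
    proof -
      have "(W ** (diag_rect b :: ('a, 'm, 'n) matrix) ** ctranspose Z) $ i $ col_of i
          = (W ** ((diag_rect b :: ('a, 'm, 'n) matrix) ** ctranspose Z)) $ i $ col_of i"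
        by (simp add: matrix_mul_assoc)
      also have "\<dots> = (\<Sum>j\<in>UNIV. W $ i $ j * (\<Sum>k\<in>UNIV. diag_rect b $ j $ k * conjugate (Z $ col_of i $ k)))"
        by (simp add: matrix_matrix_mult_def ctranspose_def)
      also have "\<dots> = (\<Sum>j\<in>UNIV. W $ i $ j * (of_real (b $ j) * conjugate (Z $ col_of i $ col_of j)))"
        by (simp add: diag_rect_nth[OF mn] if_distrib[of "\<lambda>x. x * _"] cong: if_cong)
      finally show ?thesis by (simp add: scaleR_conv_of_real mult_ac)
    qed
    have "inner 1 ((W ** diag_rect b ** ctranspose Z) $ i $ col_of i)
        = (\<Sum>j\<in>UNIV. b $ j * inner (Z $ col_of i $ col_of j) (W $ i $ j))" for i
      unfolding entry inner_sum_right
      by (simp flip: inner_mult_conjugate_left)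
    then show ?thesis unfolding inner_diag_rect[OF mn] by simp
  qed
  finally show ?thesis by (simp add: sum_distrib_left mult.assoc)
qed

definition sorted_nonneg :: "real ^ 'm::{finite,linorder} \<Rightarrow> bool" where
  "sorted_nonneg s \<longleftrightarrow> (\<forall>i j. i \<le> j \<longrightarrow> s $ j \<le> s $ i) \<and> (\<forall>i. 0 \<le> s $ i)"

text \<open>
  The squared distance of two rectangular diagonal matrices, seen in different pairs of orthonormal
  bases, as a function \<open>F\<close> of the two diagonals. The weights \<open>p\<close>, \<open>q\<close>, \<open>r\<close>, \<open>s\<close>
  depend on the bases only, so one identity serves the matrices themselves and their images under
  the spectral operator. The sums \<open>p + q\<close> dominate half of a doubly stochastic matrix \<open>d\<close>,
  which keeps enough mass near the diagonal to compare sorted diagonals.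
\<close>
locale svd_coupling =
  fixes F :: "(real, 'm::{finite,linorder}) vec \<Rightarrow> (real, 'm) vec \<Rightarrow> real"
    and p q d :: "'m::{finite,linorder} \<Rightarrow> 'm \<Rightarrow> real" and r s :: "'m::{finite,linorder} \<Rightarrow> real"
  assumes F_eq: "F a b
      = (\<Sum>i\<in>UNIV. \<Sum>j\<in>UNIV. p i j * (a $ i - b $ j)\<^sup>2 + q i j * (a $ i + b $ j)\<^sup>2)
        + (\<Sum>i\<in>UNIV. r i * (a $ i)\<^sup>2) + (\<Sum>j\<in>UNIV. s j * (b $ j)\<^sup>2)"
    and p_nonneg: "0 \<le> p i j" and q_nonneg: "0 \<le> q i j"
    and r_nonneg: "0 \<le> r i" and s_nonneg: "0 \<le> s j"
    and row_le_1: "(\<Sum>j\<in>UNIV. p i j + q i j) \<le> 1"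
    and d_nonneg: "0 \<le> d i j"
    and d_row: "(\<Sum>j\<in>UNIV. d i j) = 1" and d_col: "(\<Sum>i\<in>UNIV. d i j) = 1"
    and d_le: "d i j \<le> 2 * (p i j + q i j)"
begin

text \<open>
  A counting argument in the style of Weyl's inequality: the rows of \<open>d\<close> up to \<open>k\<close> carry one unit
  of mass more than the columns strictly before \<open>k\<close> can take, so mass at least 1 sits on pairs
  \<open>i \<le> k \<le> j\<close>; on these, monotonicity makes the distance of \<open>a $ i\<close> and \<open>b $ j\<close> at least that of
  \<open>a $ k\<close> and \<open>b $ k\<close>.
\<close>
lemma sorted_diff_le:
  assumes a: "sorted_nonneg a" and b: "sorted_nonneg b" and less: "b $ k \<le> a $ k"
  shows "(a $ k - b $ k)\<^sup>2 \<le> 2 * F a b"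
proof -
  have mass: "1 \<le> (\<Sum>i\<in>{..k}. \<Sum>j\<in>{k..}. d i j)"
  proof -
    have "real (card {..k}) = (\<Sum>i\<in>{..k}. \<Sum>j\<in>UNIV. d i j)" by (simp add: d_row)
    also have "\<dots> = (\<Sum>i\<in>{..k}. (\<Sum>j\<in>{..<k}. d i j) + (\<Sum>j\<in>{k..}. d i j))"
    proof (intro sum.cong refl)
      fix i
      have "UNIV = {..<k} \<union> {k..}" "{..<k} \<inter> {k..} = {}" by auto
      then show "(\<Sum>j\<in>UNIV. d i j) = (\<Sum>j\<in>{..<k}. d i j) + (\<Sum>j\<in>{k..}. d i j)"
        using sum.union_disjoint[of "{..<k}" "{k..}" "d i"] by simp
    qed
    also have "\<dots> = (\<Sum>j\<in>{..<k}. \<Sum>i\<in>{..k}. d i j) + (\<Sum>i\<in>{..k}. \<Sum>j\<in>{k..}. d i j)"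
      using sum.swap[of d "{..<k}" "{..k}"] by (simp add: sum.distrib)
    also have "(\<Sum>j\<in>{..<k}. \<Sum>i\<in>{..k}. d i j) \<le> (\<Sum>j\<in>{..<k}. \<Sum>i\<in>UNIV. d i j)"
      by (intro sum_mono sum_mono2) (auto simp: d_nonneg)
    also have "\<dots> = real (card {..<k})" by (simp add: d_col)
    also have "card {..k} = Suc (card {..<k})"
      by (simp flip: lessThan_Suc_atMost ivl_disj_un_singleton(2))
    finally show ?thesis by simp
  qed
  have "(a $ k - b $ k)\<^sup>2 \<le> (\<Sum>i\<in>{..k}. \<Sum>j\<in>{k..}. d i j) * (a $ k - b $ k)\<^sup>2"
    using mult_right_mono[OF mass, of "(a $ k - b $ k)\<^sup>2"] by simp
  also have "\<dots> \<le> (\<Sum>i\<in>{..k}. \<Sum>j\<in>{k..}. 2 * (p i j * (a $ i - b $ j)\<^sup>2 + q i j * (a $ i + b $ j)\<^sup>2))"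
    unfolding sum_distrib_right
  proof (intro sum_mono)
    fix i j assume "i \<in> {..k}" "j \<in> {k..}"
    then have "a $ k \<le> a $ i" "b $ j \<le> b $ k" using a b by (auto simp: sorted_nonneg_def)
    then have le: "a $ k - b $ k \<le> a $ i - b $ j" by simp
    have "(a $ k - b $ k)\<^sup>2 \<le> (a $ i - b $ j)\<^sup>2" using le less by (intro power_mono) auto
    moreover have "0 \<le> b $ j" using b by (simp add: sorted_nonneg_def)
    moreover have "(a $ i - b $ j)\<^sup>2 \<le> (a $ i + b $ j)\<^sup>2"
      using \<open>0 \<le> b $ j\<close> le less by (intro power_mono) auto
    ultimately have "p i j * (a $ k - b $ k)\<^sup>2 \<le> p i j * (a $ i - b $ j)\<^sup>2"
      "q i j * (a $ k - b $ k)\<^sup>2 \<le> q i j * (a $ i + b $ j)\<^sup>2"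
      by (auto intro!: mult_left_mono p_nonneg q_nonneg intro: order_trans)
    moreover have "d i j * (a $ k - b $ k)\<^sup>2 \<le> (2 * (p i j + q i j)) * (a $ k - b $ k)\<^sup>2"
      by (intro mult_right_mono d_le) simp
    ultimately show "d i j * (a $ k - b $ k)\<^sup>2 \<le> 2 * (p i j * (a $ i - b $ j)\<^sup>2 + q i j * (a $ i + b $ j)\<^sup>2)"
      by (simp add: distrib_left distrib_right)
  qed
  also have "\<dots> \<le> (\<Sum>i\<in>{..k}. \<Sum>j\<in>UNIV. 2 * (p i j * (a $ i - b $ j)\<^sup>2 + q i j * (a $ i + b $ j)\<^sup>2))"
    by (intro sum_mono sum_mono2) (auto simp: p_nonneg q_nonneg)
  also have "\<dots> \<le> (\<Sum>i\<in>UNIV. \<Sum>j\<in>UNIV. 2 * (p i j * (a $ i - b $ j)\<^sup>2 + q i j * (a $ i + b $ j)\<^sup>2))"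
    by (intro sum_mono2) (auto intro!: sum_nonneg simp: p_nonneg q_nonneg)
  also have "\<dots> \<le> 2 * F a b"
  proof -
    have "0 \<le> (\<Sum>i\<in>UNIV. r i * (a $ i)\<^sup>2)" "0 \<le> (\<Sum>j\<in>UNIV. s j * (b $ j)\<^sup>2)"
      by (auto intro!: sum_nonneg simp: r_nonneg s_nonneg)
    from add_nonneg_nonneg[OF this] show ?thesis
      unfolding F_eq sum_distrib_left[symmetric] by (intro mult_left_mono) (simp_all add: add.assoc)
  qed
  finally show ?thesis .
qed

text \<open>
  The identity for \<open>F\<close> carries bounds on differences, sums and single entries over term by term. The
  error \<open>\<delta>\<close> costs a factor \<open>CARD('m)\<close> only, since the weights have total mass at most \<open>CARD('m)\<close>.
\<close>
lemma transfer_le: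
  assumes pair: "\<And>i j e. e = 1 \<or> e = -1 \<Longrightarrow> \<bar>a' $ i - e * b' $ j\<bar> \<le> K * (\<delta> + \<bar>a $ i - e * b $ j\<bar>)"
    and a: "\<And>i. \<bar>a' $ i\<bar> \<le> K * \<bar>a $ i\<bar>" and b: "\<And>j. \<bar>b' $ j\<bar> \<le> K * \<bar>b $ j\<bar>"
  shows "F a' b' \<le> 2 * K\<^sup>2 * (F a b + real CARD('m) * \<delta>\<^sup>2)"
proof -
  have sq: "x\<^sup>2 \<le> 2 * K\<^sup>2 * (\<delta>\<^sup>2 + y\<^sup>2)" if "\<bar>x\<bar> \<le> K * (\<delta> + \<bar>y\<bar>)" for x y
  proof -
    have "x\<^sup>2 \<le> (K * (\<delta> + \<bar>y\<bar>))\<^sup>2" using that abs_le_square_iff by fastforce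
    also have "\<dots> = K\<^sup>2 * (\<delta> + \<bar>y\<bar>)\<^sup>2" by (simp add: power_mult_distrib)
    also have "\<dots> \<le> K\<^sup>2 * (2 * (\<delta>\<^sup>2 + y\<^sup>2))"
      using sum_squares_bound[of \<delta> "\<bar>y\<bar>"] by (intro mult_left_mono) (auto simp: power2_sum)
    finally show ?thesis by (simp add: algebra_simps)
  qed
  have sq': "x\<^sup>2 \<le> 2 * K\<^sup>2 * y\<^sup>2" if "\<bar>x\<bar> \<le> K * \<bar>y\<bar>" for x y
  proof -
    have "x\<^sup>2 \<le> (K * \<bar>y\<bar>)\<^sup>2" using that abs_le_square_iff by fastforce
    moreover have "(K * \<bar>y\<bar>)\<^sup>2 \<le> 2 * (K * \<bar>y\<bar>)\<^sup>2" by simp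
    ultimately have "x\<^sup>2 \<le> 2 * (K * \<bar>y\<bar>)\<^sup>2" by linarith
    then show ?thesis by (simp add: power_mult_distrib)
  qed
  have entry: "p i j * (a' $ i - b' $ j)\<^sup>2 + q i j * (a' $ i + b' $ j)\<^sup>2
      \<le> 2 * K\<^sup>2 * (p i j * (a $ i - b $ j)\<^sup>2 + q i j * (a $ i + b $ j)\<^sup>2)
        + 2 * K\<^sup>2 * \<delta>\<^sup>2 * (p i j + q i j)" for i j
  proof -
    have "p i j * (a' $ i - b' $ j)\<^sup>2 \<le> p i j * (2 * K\<^sup>2 * (\<delta>\<^sup>2 + (a $ i - b $ j)\<^sup>2))"
      using pair[of 1 i j] by (intro mult_left_mono p_nonneg sq) simp
    moreover have "q i j * (a' $ i + b' $ j)\<^sup>2 \<le> q i j * (2 * K\<^sup>2 * (\<delta>\<^sup>2 + (a $ i + b $ j)\<^sup>2))"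
      using pair[of "-1" i j] by (intro mult_left_mono q_nonneg sq) simp
    ultimately show ?thesis by (simp add: algebra_simps)
  qed
  have lin: "(\<Sum>i\<in>UNIV. \<Sum>j\<in>UNIV. c * A i j + e * B i j)
      = c * (\<Sum>i\<in>UNIV. \<Sum>j\<in>UNIV. A i j) + e * (\<Sum>i\<in>UNIV. \<Sum>j\<in>UNIV. B i j)"
    for c e :: real and A B :: "'m \<Rightarrow> 'm \<Rightarrow> real"
    by (simp add: sum.distrib sum_distrib_left)
  have "(\<Sum>i\<in>UNIV. \<Sum>j\<in>UNIV. p i j * (a' $ i - b' $ j)\<^sup>2 + q i j * (a' $ i + b' $ j)\<^sup>2)
      \<le> (\<Sum>i\<in>UNIV. \<Sum>j\<in>UNIV. 2 * K\<^sup>2 * (p i j * (a $ i - b $ j)\<^sup>2 + q i j * (a $ i + b $ j)\<^sup>2)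
        + 2 * K\<^sup>2 * \<delta>\<^sup>2 * (p i j + q i j))"
    by (intro sum_mono entry)
  also have "\<dots> = 2 * K\<^sup>2 * (\<Sum>i\<in>UNIV. \<Sum>j\<in>UNIV. p i j * (a $ i - b $ j)\<^sup>2 + q i j * (a $ i + b $ j)\<^sup>2)
      + 2 * K\<^sup>2 * \<delta>\<^sup>2 * (\<Sum>i\<in>UNIV. \<Sum>j\<in>UNIV. p i j + q i j)"
    by (rule lin)
  also have "(\<Sum>i\<in>UNIV. \<Sum>j\<in>UNIV. p i j + q i j) \<le> (\<Sum>i\<in>(UNIV::'m set). 1)"
    by (intro sum_mono row_le_1)
  finally have pq: "(\<Sum>i\<in>UNIV. \<Sum>j\<in>UNIV. p i j * (a' $ i - b' $ j)\<^sup>2 + q i j * (a' $ i + b' $ j)\<^sup>2)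
      \<le> 2 * K\<^sup>2 * (\<Sum>i\<in>UNIV. \<Sum>j\<in>UNIV. p i j * (a $ i - b $ j)\<^sup>2 + q i j * (a $ i + b $ j)\<^sup>2)
      + 2 * K\<^sup>2 * \<delta>\<^sup>2 * real CARD('m)"
    by (simp add: mult_left_mono)
  have "(\<Sum>i\<in>UNIV. r i * (a' $ i)\<^sup>2) \<le> (\<Sum>i\<in>UNIV. r i * (2 * K\<^sup>2 * (a $ i)\<^sup>2))"
    by (intro sum_mono mult_left_mono sq' a r_nonneg)
  moreover have "(\<Sum>j\<in>UNIV. s j * (b' $ j)\<^sup>2) \<le> (\<Sum>j\<in>UNIV. s j * (2 * K\<^sup>2 * (b $ j)\<^sup>2))"
    by (intro sum_mono mult_left_mono sq' b s_nonneg)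
  moreover have "(\<Sum>i\<in>UNIV. r i * (2 * K\<^sup>2 * (a $ i)\<^sup>2)) = 2 * K\<^sup>2 * (\<Sum>i\<in>UNIV. r i * (a $ i)\<^sup>2)"
    "(\<Sum>j\<in>UNIV. s j * (2 * K\<^sup>2 * (b $ j)\<^sup>2)) = 2 * K\<^sup>2 * (\<Sum>j\<in>UNIV. s j * (b $ j)\<^sup>2)"
    by (simp_all add: sum_distrib_left mult_ac)
  ultimately show ?thesis using pq unfolding F_eq
    by (simp add: distrib_left mult.assoc mult.commute[of "real CARD('m)"])
qed

text \<open>
  All terms of the identity are nonnegative, so all of them vanish with \<open>F\<close>: a positive weight sits on a pair
  of entries that agree up to sign, or on an entry that is zero. This makes the value of the
  spectral operator independent of the decomposition.
\<close>
lemma transfer_eq_0: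
  assumes zero: "F a b = 0"
    and pair: "\<And>i j e. e = 1 \<or> e = -1 \<Longrightarrow> a $ i = e * b $ j \<Longrightarrow> a' $ i = e * b' $ j"
    and a: "\<And>i. a $ i = 0 \<Longrightarrow> a' $ i = 0" and b: "\<And>j. b $ j = 0 \<Longrightarrow> b' $ j = 0"
  shows "F a' b' = 0"
proof -
  let ?pq = "\<lambda>i j. p i j * (a $ i - b $ j)\<^sup>2 + q i j * (a $ i + b $ j)\<^sup>2"
  have nn: "0 \<le> ?pq i j" "0 \<le> (\<Sum>j\<in>UNIV. ?pq i j)" "0 \<le> (\<Sum>i\<in>UNIV. \<Sum>j\<in>UNIV. ?pq i j)"
    "0 \<le> (\<Sum>i\<in>UNIV. r i * (a $ i)\<^sup>2)" "0 \<le> (\<Sum>j\<in>UNIV. s j * (b $ j)\<^sup>2)" for i j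
    by (auto intro!: sum_nonneg add_nonneg_nonneg mult_nonneg_nonneg p_nonneg q_nonneg r_nonneg s_nonneg)
  have z: "(\<Sum>i\<in>UNIV. \<Sum>j\<in>UNIV. ?pq i j) = 0"
    "(\<Sum>i\<in>UNIV. r i * (a $ i)\<^sup>2) = 0" "(\<Sum>j\<in>UNIV. s j * (b $ j)\<^sup>2) = 0"
    using zero nn(3-5) unfolding F_eq by linarith+
  have "(\<Sum>j\<in>UNIV. ?pq i j) = 0" for i
    using z(1) sum_nonneg_eq_0_iff[of UNIV "\<lambda>i. \<Sum>j\<in>UNIV. ?pq i j"] nn(2) by simp
  then have pq0: "?pq i j = 0" for i j
    using sum_nonneg_eq_0_iff[of UNIV "?pq i"] nn(1) by simp
  have "p i j * (a' $ i - b' $ j)\<^sup>2 + q i j * (a' $ i + b' $ j)\<^sup>2 = 0" for i j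
  proof -
    have "p i j * (a $ i - b $ j)\<^sup>2 = 0 \<and> q i j * (a $ i + b $ j)\<^sup>2 = 0"
      using pq0[of i j] p_nonneg[of i j] q_nonneg[of i j] by (subst (asm) add_nonneg_eq_0_iff) auto
    then show ?thesis using pair[of 1 i j] pair[of "-1" i j] by auto
  qed
  moreover have "r i * (a' $ i)\<^sup>2 = 0" for i
    using z(2) sum_nonneg_eq_0_iff[of UNIV "\<lambda>i. r i * (a $ i)\<^sup>2"] r_nonneg a[of i] by auto
  moreover have "s j * (b' $ j)\<^sup>2 = 0" for j
    using z(3) sum_nonneg_eq_0_iff[of UNIV "\<lambda>j. s j * (b $ j)\<^sup>2"] s_nonneg b[of j] by auto
  ultimately show ?thesis unfolding F_eq by (simp only: sum.neutral_const add_0)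
qed

end

text \<open>
  With \<open>W = U* U'\<close> and \<open>Z = V* V'\<close>, the inner product of the two matrices has the coefficients
  \<open>\<langle>Z i j, W i j\<rangle>\<close>, and these are differences of the squares
  \<open>p = |Z + W|\<^sup>2 / 4\<close> and \<open>q = |Z - W|\<^sup>2 / 4\<close>, whose sum is \<open>(|Z|\<^sup>2 + |W|\<^sup>2) / 2\<close>. As \<open>W\<close> is
  unitary, \<open>|W|\<^sup>2\<close> is doubly stochastic; \<open>Z\<close> is cut to the first \<open>CARD('m)\<close> rows and columns, so its
  row and column sums are at most 1. The defects of the row and column sums of \<open>p + q\<close> are \<open>r\<close> and
  \<open>s\<close>; they account for the columns beyond the square block.
\<close>
lemma obtain_svd_coupling:
  fixes U U' :: "('a::hermitian_field, 'm::{finite,linorder}, 'm) matrix"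
    and V V' :: "('a, 'n::{finite,linorder}, 'n) matrix"
  assumes mn: "CARD('m) \<le> CARD('n)"
    and unit: "unitary_matrix U" "unitary_matrix U'" "unitary_matrix V" "unitary_matrix V'"
  obtains p q d r s where "svd_coupling
    (\<lambda>a b. (norm (U ** diag_rect a ** ctranspose V - U' ** diag_rect b ** ctranspose V'))\<^sup>2) p q d r s"
proof -
  define W where "W = ctranspose U ** U'"
  define Z where "Z = ctranspose V ** V'"
  let ?c = "col_of :: 'm \<Rightarrow> 'n"
  let ?Z = "\<lambda>i j. Z $ ?c i $ ?c j"
  have uW: "unitary_matrix W" and uZ: "unitary_matrix Z"
    using unit by (simp_all add: W_def Z_def unitary_matrix_mult unitary_matrix_ctranspose)
  have inj: "inj ?c" by (simp add: inj_def col_of_eq_iff[OF mn])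
  have Zrow: "(\<Sum>j\<in>UNIV. (norm (?Z i j))\<^sup>2) \<le> 1" for i
  proof -
    have "(\<Sum>j\<in>UNIV. (norm (?Z i j))\<^sup>2) = (\<Sum>k\<in>range ?c. (norm (Z $ ?c i $ k))\<^sup>2)"
      by (simp add: sum.reindex[OF inj])
    also have "\<dots> \<le> (\<Sum>k\<in>UNIV. (norm (Z $ ?c i $ k))\<^sup>2)" by (rule sum_mono2) auto
    finally show ?thesis by (simp add: unitary_matrix_row_sum[OF uZ])
  qed
  have Zcol: "(\<Sum>i\<in>UNIV. (norm (?Z i j))\<^sup>2) \<le> 1" for j
  proof -
    have "(\<Sum>i\<in>UNIV. (norm (?Z i j))\<^sup>2) = (\<Sum>k\<in>range ?c. (norm (Z $ k $ ?c j))\<^sup>2)"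
      by (simp add: sum.reindex[OF inj])
    also have "\<dots> \<le> (\<Sum>k\<in>UNIV. (norm (Z $ k $ ?c j))\<^sup>2)" by (rule sum_mono2) auto
    finally show ?thesis by (simp add: unitary_matrix_col_sum[OF uZ])
  qed
  define p where "p i j = (norm (?Z i j + W $ i $ j))\<^sup>2 / 4" for i j
  define q where "q i j = (norm (?Z i j - W $ i $ j))\<^sup>2 / 4" for i j
  define d where "d i j = (norm (W $ i $ j))\<^sup>2" for i j
  have pq_plus: "p i j + q i j = ((norm (?Z i j))\<^sup>2 + d i j) / 2" for i j
    unfolding p_def q_def d_def power2_norm_eq_inner
    by (simp add: inner_diff_left inner_diff_right inner_add_left inner_add_right
        add_divide_distrib diff_divide_distrib)
  have pq_minus: "p i j - q i j = inner (?Z i j) (W $ i $ j)" for i j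
    unfolding p_def q_def power2_norm_eq_inner
    by (simp add: inner_diff_left inner_diff_right inner_add_left inner_add_right
        inner_commute add_divide_distrib diff_divide_distrib)
  define r where "r i = 1 - (\<Sum>j\<in>UNIV. p i j + q i j)" for i
  define s where "s j = 1 - (\<Sum>i\<in>UNIV. p i j + q i j)" for j
  have drow: "(\<Sum>j\<in>UNIV. d i j) = 1" for i
    unfolding d_def by (rule unitary_matrix_row_sum[OF uW])
  have dcol: "(\<Sum>i\<in>UNIV. d i j) = 1" for j
    unfolding d_def by (rule unitary_matrix_col_sum[OF uW])
  have r0: "0 \<le> r i" for i
    using Zrow[of i] drow[of i]
    by (simp add: r_def pq_plus sum.distrib flip: sum_divide_distrib)
  have s0: "0 \<le> s j" for j
    using Zcol[of j] dcol[of j]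
    by (simp add: s_def pq_plus sum.distrib flip: sum_divide_distrib)
  have "svd_coupling
    (\<lambda>a b. (norm (U ** diag_rect a ** ctranspose V - U' ** diag_rect b ** ctranspose V'))\<^sup>2) p q d r s"
  proof
    show "0 \<le> p i j" "0 \<le> q i j" "0 \<le> d i j" for i j by (simp_all add: p_def q_def d_def)
    show "0 \<le> r i" for i by (rule r0)
    show "0 \<le> s j" for j by (rule s0)
    show "(\<Sum>j\<in>UNIV. d i j) = 1" for i by (rule drow)
    show "(\<Sum>i\<in>UNIV. d i j) = 1" for j by (rule dcol)
    show "(\<Sum>j\<in>UNIV. p i j + q i j) \<le> 1" for i using r0[of i] by (simp add: r_def)
    show "d i j \<le> 2 * (p i j + q i j)" for i j by (simp add: pq_plus)
    fix a b :: "(real, 'm) vec"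
    let ?A = "U ** diag_rect a ** ctranspose V" and ?B = "U' ** diag_rect b ** ctranspose V'"
    have "(norm (?A - ?B))\<^sup>2 = (norm ?A)\<^sup>2 + (norm ?B)\<^sup>2 - 2 * inner ?A ?B"
      unfolding power2_norm_eq_inner by (simp add: inner_diff_left inner_diff_right inner_commute)
    also have "(norm ?A)\<^sup>2 = (\<Sum>i\<in>UNIV. (a $ i)\<^sup>2)"
      by (simp add: norm_unitary_matrix unit norm_diag_rect[OF mn] norm_vec_power2)
    also have "(norm ?B)\<^sup>2 = (\<Sum>j\<in>UNIV. (b $ j)\<^sup>2)"
      by (simp add: norm_unitary_matrix unit norm_diag_rect[OF mn] norm_vec_power2)
    also have "inner ?A ?B = (\<Sum>i\<in>UNIV. \<Sum>j\<in>UNIV. a $ i * b $ j * (p i j - q i j))"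
      unfolding pq_minus W_def Z_def by (rule inner_rect_svd[OF mn])
    also have "(\<Sum>i\<in>UNIV. (a $ i)\<^sup>2)
        = (\<Sum>i\<in>UNIV. \<Sum>j\<in>UNIV. (p i j + q i j) * (a $ i)\<^sup>2) + (\<Sum>i\<in>UNIV. r i * (a $ i)\<^sup>2)"
      by (simp add: r_def left_diff_distrib sum_subtractf sum_distrib_right)
    also have "(\<Sum>j\<in>UNIV. (b $ j)\<^sup>2)
        = (\<Sum>i\<in>UNIV. \<Sum>j\<in>UNIV. (p i j + q i j) * (b $ j)\<^sup>2) + (\<Sum>j\<in>UNIV. s j * (b $ j)\<^sup>2)"
      by (subst sum.swap) (simp add: s_def left_diff_distrib sum_subtractf sum_distrib_right)
    finally have "(norm (?A - ?B))\<^sup>2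
      = ((\<Sum>i\<in>UNIV. \<Sum>j\<in>UNIV. (p i j + q i j) * (a $ i)\<^sup>2) + (\<Sum>i\<in>UNIV. \<Sum>j\<in>UNIV. (p i j + q i j) * (b $ j)\<^sup>2)
         - 2 * (\<Sum>i\<in>UNIV. \<Sum>j\<in>UNIV. a $ i * b $ j * (p i j - q i j)))
        + (\<Sum>i\<in>UNIV. r i * (a $ i)\<^sup>2) + (\<Sum>j\<in>UNIV. s j * (b $ j)\<^sup>2)" by simp
    also have "(\<Sum>i\<in>UNIV. \<Sum>j\<in>UNIV. (p i j + q i j) * (a $ i)\<^sup>2) + (\<Sum>i\<in>UNIV. \<Sum>j\<in>UNIV. (p i j + q i j) * (b $ j)\<^sup>2)
         - 2 * (\<Sum>i\<in>UNIV. \<Sum>j\<in>UNIV. a $ i * b $ j * (p i j - q i j))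
      = (\<Sum>i\<in>UNIV. \<Sum>j\<in>UNIV. p i j * (a $ i - b $ j)\<^sup>2 + q i j * (a $ i + b $ j)\<^sup>2)"
      unfolding sum_distrib_left sum_subtractf[symmetric] sum.distrib[symmetric]
      by (intro sum.cong refl) (simp add: power2_eq_square algebra_simps)
    finally show "(norm (?A - ?B))\<^sup>2
      = (\<Sum>i\<in>UNIV. \<Sum>j\<in>UNIV. p i j * (a $ i - b $ j)\<^sup>2 + q i j * (a $ i + b $ j)\<^sup>2)
        + (\<Sum>i\<in>UNIV. r i * (a $ i)\<^sup>2) + (\<Sum>j\<in>UNIV. s j * (b $ j)\<^sup>2)" .
  qed
  then show thesis by (rule that)
qed

text \<open>
  The source of two facts: for equal matrices it is the uniqueness of singular values, in general
  their Lipschitz continuity.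
\<close>
lemma svd_sorted_diff_le:
  fixes U U' :: "('a::hermitian_field, 'm::{finite,linorder}, 'm) matrix"
    and V V' :: "('a, 'n::{finite,linorder}, 'n) matrix"
  assumes mn: "CARD('m) \<le> CARD('n)"
    and unit: "unitary_matrix U" "unitary_matrix U'" "unitary_matrix V" "unitary_matrix V'"
    and sorted: "sorted_nonneg a" "sorted_nonneg b"
  shows "(a $ k - b $ k)\<^sup>2
    \<le> 2 * (norm (U ** diag_rect a ** ctranspose V - U' ** diag_rect b ** ctranspose V'))\<^sup>2"
proof (cases "b $ k \<le> a $ k")
  case True
  obtain p q d r s where "svd_coupling
    (\<lambda>a b. (norm (U ** diag_rect a ** ctranspose V - U' ** diag_rect b ** ctranspose V'))\<^sup>2) p q d r s"
    by (rule obtain_svd_coupling[OF mn unit])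
  from svd_coupling.sorted_diff_le[OF this sorted True] show ?thesis .
next
  case False
  obtain p q d r s where "svd_coupling
    (\<lambda>a b. (norm (U' ** diag_rect a ** ctranspose V' - U ** diag_rect b ** ctranspose V))\<^sup>2) p q d r s"
    by (rule obtain_svd_coupling[OF mn unit(2) unit(1) unit(4) unit(3)])
  from svd_coupling.sorted_diff_le[OF this sorted(2,1), of k] False show ?thesis
    by (simp add: power2_commute norm_minus_commute)
qed

section \<open>Signed permutations of the diagonal\<close>

lemma unitary_matrix_monomial:
  fixes u :: "'p::finite \<Rightarrow> 'a::hermitian_field"
  assumes "inj \<pi>" "\<And>i. norm (u i) = 1"
  shows "unitary_matrix (\<chi> i j. if j = \<pi> i then u i else 0)" (is "unitary_matrix ?P")
proof -
  have "?P ** ctranspose ?P = mat 1"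
  proof -
    have "(\<Sum>k\<in>UNIV. (if k = \<pi> i then u i else 0) * conjugate (if k = \<pi> j then u j else 0))
        = (if i = j then 1 else 0)" for i j
    proof -
      have "(\<Sum>k\<in>UNIV. (if k = \<pi> i then u i else 0) * conjugate (if k = \<pi> j then u j else 0))
        = (\<Sum>k\<in>UNIV. if k = \<pi> i then u i * conjugate (if \<pi> i = \<pi> j then u j else 0) else 0)"
        by (intro sum.cong refl) auto
      also have "\<dots> = u i * conjugate (if \<pi> i = \<pi> j then u j else 0)" by simp
      also have "\<dots> = (if i = j then 1 else 0)"
        using assms conjugate_mult_self[of "u i"] by (auto simp: inj_eq mult.commute)
      finally show ?thesis .
    qed
    then show ?thesis
      by (simp add: vec_eq_iff matrix_matrix_mult_def ctranspose_def mat_def)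
  qed
  then show ?thesis using matrix_left_right_inverse unitary_matrix_def by blast
qed

text \<open>
  Every signed permutation matrix has this form; the explicit signs and permutation make it
  possible to act on the two sides of a rectangular diagonal matrix separately.
\<close>
definition signed_perm :: "('m \<Rightarrow> real) \<Rightarrow> ('m \<Rightarrow> 'm) \<Rightarrow> real ^ 'm ^ 'm" where
  "signed_perm e \<pi> = (\<chi> i j. if j = \<pi> i then e i else 0)"

lemma signed_perm_mult_nth:
  "(signed_perm e \<pi> *v x) $ i = e i * x $ \<pi> i"
  by (simp add: signed_perm_def matrix_vector_mult_def if_distrib[of "\<lambda>z. z * _"] cong: if_cong)

lemma signed_permutation_matrix_signed_perm:
  assumes "bij \<pi>" "\<And>i. e i = 1 \<or> e i = -1"
  shows "signed_permutation_matrix (signed_perm e \<pi>)"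
proof -
  have nz: "e i \<noteq> 0" for i using assms(2)[of i] by auto
  have "\<exists>!i. j = \<pi> i" for j using assms(1) by (metis bij_pointE)
  then show ?thesis
    using assms(2) nz by (auto simp: signed_permutation_matrix_def signed_perm_def)
qed

lemma obtain_sorting_signed_perm:
  fixes y :: "real ^ 'm::{finite,linorder}"
  obtains e \<pi> where "bij \<pi>" "\<And>i. e i = 1 \<or> e i = -1" "sorted_nonneg (signed_perm e \<pi> *v y)"
proof -
  define xs where "xs = sort_key (\<lambda>i. - \<bar>y $ i\<bar>) (sorted_list_of_set (UNIV :: 'm set))"
  have xs: "distinct xs" "set xs = UNIV" "length xs = CARD('m)"
    by (simp_all add: xs_def)
  have sorted: "sorted (map (\<lambda>i. - \<bar>y $ i\<bar>) xs)" by (simp add: xs_def)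
  have pos_lt: "idx_pos i < length xs" for i :: 'm
    using range_idx_pos[where 'i='m] xs(3) by auto
  define \<pi> where "\<pi> i = xs ! idx_pos i" for i :: 'm
  define e where "e i = (if 0 \<le> y $ \<pi> i then 1 else - 1 :: real)" for i
  have "inj \<pi>"
    unfolding \<pi>_def inj_def using nth_eq_iff_index_eq[OF xs(1)] pos_lt idx_pos_eq_iff by metis
  then have bij: "bij \<pi>" by (simp add: bij_def finite_UNIV_inj_surj)
  have eq: "(signed_perm e \<pi> *v y) $ i = \<bar>y $ \<pi> i\<bar>" for i
    by (simp add: signed_perm_mult_nth e_def)
  have "\<bar>y $ \<pi> j\<bar> \<le> \<bar>y $ \<pi> i\<bar>" if "i \<le> j" for i j
  proof -
    have "idx_pos i \<le> idx_pos j" using that idx_pos_less[of i j] by (auto simp: le_less)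
    then have "map (\<lambda>i. - \<bar>y $ i\<bar>) xs ! idx_pos i \<le> map (\<lambda>i. - \<bar>y $ i\<bar>) xs ! idx_pos j"
      using sorted pos_lt by (intro sorted_nth_mono) auto
    then show ?thesis using pos_lt by (simp add: \<pi>_def)
  qed
  then have "sorted_nonneg (signed_perm e \<pi> *v y)" by (simp add: sorted_nonneg_def eq)
  then show ?thesis using that[OF bij, of e] by (simp add: e_def)
qed

text \<open>
  The signs are put into the row factor, so that the column factor is a plain permutation matrix:
  the permutation of the rows carried over by \<open>col_of\<close> and extended by the identity.
\<close>
lemma diag_rect_signed_perm:
  fixes \<pi> :: "'m::{finite,linorder} \<Rightarrow> 'm"
  assumes mn: "CARD('m) \<le> CARD('n::{finite,linorder})"
    and \<pi>: "bij \<pi>" and e: "\<And>i. e i = 1 \<or> e i = -1"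
  obtains P :: "('a::hermitian_field, 'm::{finite,linorder}, 'm) matrix" and R :: "('a, 'n::{finite,linorder}, 'n) matrix"
  where "unitary_matrix P" "unitary_matrix R"
    "\<And>x. diag_rect (signed_perm e \<pi> *v x) = P ** diag_rect x ** ctranspose R"
proof -
  let ?c = "col_of :: 'm \<Rightarrow> 'n"
  have inj_c: "inj ?c" by (simp add: inj_def col_of_eq_iff[OF mn])
  define \<rho> where "\<rho> k = (if k \<in> range ?c then ?c (\<pi> (inv ?c k)) else k)" for k
  have \<rho>_c: "\<rho> (?c i) = ?c (\<pi> i)" for i by (simp add: \<rho>_def inj_c)
  have inj_\<rho>: "inj \<rho>"
  proof (rule injI)
    fix k l assume eq: "\<rho> k = \<rho> l"
    have "k \<in> range ?c \<longleftrightarrow> \<rho> k \<in> range ?c" for k by (auto simp: \<rho>_def)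
    then have iff: "k \<in> range ?c \<longleftrightarrow> l \<in> range ?c" using eq by metis
    show "k = l"
    proof (cases "k \<in> range ?c")
      case True
      then obtain i j where "k = ?c i" "l = ?c j" using iff by blast
      then show ?thesis using eq \<pi> inj_c by (simp add: \<rho>_c inj_eq bij_is_inj)
    next
      case False
      then show ?thesis using eq iff by (simp add: \<rho>_def)
    qed
  qed
  have \<rho>_iff: "\<rho> k = ?c (\<pi> i) \<longleftrightarrow> k = ?c i" for k i
    using inj_\<rho> \<rho>_c by (metis injD)
  define P :: "('a, 'm, 'm) matrix" where "P = (\<chi> i j. if j = \<pi> i then of_real (e i) else 0)"
  define R :: "('a, 'n, 'n) matrix" where "R = (\<chi> k l. if l = \<rho> k then 1 else 0)"
  have "unitary_matrix P"
    unfolding P_def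
  proof (rule unitary_matrix_monomial)
    show "norm (of_real (e i) :: 'a) = 1" for i using e[of i] by auto
  qed (use \<pi> in \<open>simp add: bij_is_inj\<close>)
  moreover have "unitary_matrix R"
    unfolding R_def by (rule unitary_matrix_monomial[OF inj_\<rho>]) simp
  moreover have "diag_rect (signed_perm e \<pi> *v x) = P ** diag_rect x ** ctranspose R" for x
  proof -
    have "(P ** (diag_rect x ** ctranspose R)) $ i $ k = diag_rect (signed_perm e \<pi> *v x) $ i $ k" for i k
    proof -
      have "(P ** (diag_rect x ** ctranspose R)) $ i $ k
          = (\<Sum>j\<in>UNIV. P $ i $ j * (\<Sum>l\<in>UNIV. diag_rect x $ j $ l * conjugate (R $ k $ l)))"
        by (simp add: matrix_matrix_mult_def ctranspose_def)
      also have "\<dots> = of_real (e i) * diag_rect x $ \<pi> i $ \<rho> k"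
        by (simp add: P_def R_def if_distrib[of "\<lambda>z. z * _"] if_distrib[of "\<lambda>z. _ * z"]
            if_distrib[of conjugate] cong: if_cong)
      also have "\<dots> = diag_rect (signed_perm e \<pi> *v x) $ i $ k"
        by (simp add: diag_rect_nth[OF mn] signed_perm_mult_nth \<rho>_iff)
      finally show ?thesis .
    qed
    then show ?thesis by (simp add: vec_eq_iff matrix_mul_assoc)
  qed
  ultimately show ?thesis using that by blast
qed

text \<open>
  One signed permutation and one new pair of unitary factors serve all diagonals \<open>x\<close> at once. This
  is what allows the diagonals \<open>y\<close> and \<open>g y\<close> to be rearranged simultaneously.
\<close>
lemma obtain_sorted_svd:
  fixes U :: "('a::hermitian_field, 'm::{finite,linorder}, 'm) matrix"
    and V :: "('a, 'n::{finite,linorder}, 'n) matrix"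
  assumes mn: "CARD('m) \<le> CARD('n)" and unit: "unitary_matrix U" "unitary_matrix V"
  obtains Q U' V' where "signed_permutation_matrix Q" "sorted_nonneg (Q *v y)"
    "unitary_matrix U'" "unitary_matrix V'"
    "\<And>x. U ** diag_rect x ** ctranspose V = U' ** diag_rect (Q *v x) ** ctranspose V'"
proof -
  obtain e \<pi> where \<pi>: "bij \<pi>" and e: "\<And>i. e i = 1 \<or> e i = -1"
    and sorted: "sorted_nonneg (signed_perm e \<pi> *v y)"
    using obtain_sorting_signed_perm[of y] by metis
  obtain P :: "('a, 'm, 'm) matrix" and R :: "('a, 'n::{finite,linorder}, 'n) matrix"
    where PR: "unitary_matrix P" "unitary_matrix R"
    "\<And>x. diag_rect (signed_perm e \<pi> *v x) = P ** diag_rect x ** ctranspose R"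
    using diag_rect_signed_perm[OF mn \<pi>, of e] e by metis
  have "(U ** ctranspose P) ** diag_rect (signed_perm e \<pi> *v x) ** ctranspose (V ** ctranspose R)
      = U ** diag_rect x ** ctranspose V" for x
  proof -
    have "(U ** ctranspose P) ** diag_rect (signed_perm e \<pi> *v x) ** ctranspose (V ** ctranspose R)
      = U ** (ctranspose P ** P) ** diag_rect x ** (ctranspose R ** R) ** ctranspose V"
      by (simp add: PR(3) ctranspose_matrix_mult matrix_mul_assoc)
    then show ?thesis using PR by (simp add: unitary_matrix_def)
  qed
  then show ?thesis
    using that[OF signed_permutation_matrix_signed_perm[OF \<pi> e] sorted, of "U ** ctranspose P" "V ** ctranspose R"]
      unit PR by (simp add: unitary_matrix_mult unitary_matrix_ctranspose)
qed

section \<open>Existence of singular value decompositions\<close>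

text \<open>
  The equality case of the Cauchy-Schwarz inequality against 1.
\<close>
lemma inner_one_of_norm:
  fixes z :: "'a::hermitian_field"
  assumes "norm z \<le> inner 1 z"
  shows "z = of_real (norm z)"
proof -
  have "(norm (z - of_real (norm z)))\<^sup>2 = 2 * (norm z)\<^sup>2 - 2 * (norm z * inner 1 z)"
    by (simp add: power2_norm_eq_inner inner_diff_left inner_diff_right of_real_def inner_commute)
      (simp add: power2_norm_eq_inner[symmetric] power2_eq_square)
  also have "\<dots> \<le> 0" using mult_left_mono[OF assms norm_ge_zero[of z]] by (simp add: power2_eq_square)
  finally show ?thesis by simp
qed

definition plane_rotation :: "'p::finite \<Rightarrow> 'p \<Rightarrow> real \<Rightarrow> real \<Rightarrow> 'a::hermitian_field \<Rightarrow> 'a ^ 'p ^ 'p" where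
  "plane_rotation i k c s u = (\<chi> a b.
     if a = i \<and> b = i \<or> a = k \<and> b = k then of_real c
     else if a = i \<and> b = k then of_real s * u
     else if a = k \<and> b = i then - (of_real s * conjugate u)
     else if a = b then 1 else 0)"

lemma sum_split_two:
  fixes f :: "'p::finite \<Rightarrow> 'b::comm_monoid_add"
  assumes "i \<noteq> k"
  shows "sum f UNIV = f i + f k + sum f (- {i, k})"
proof -
  have "sum f UNIV = sum f ({i, k} \<union> - {i, k})" by simp
  also have "\<dots> = sum f {i, k} + sum f (- {i, k})" by (rule sum.union_disjoint) auto
  finally show ?thesis using assms by simp
qed

lemma unitary_plane_rotation:
  fixes u :: "'a::hermitian_field"
  assumes ik: "i \<noteq> k" and cs: "c\<^sup>2 + s\<^sup>2 = 1" and u: "norm u = 1"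
  shows "unitary_matrix (plane_rotation i k c s u)" (is "unitary_matrix ?Q")
proof (rule unitary_matrixI)
  have uu: "conjugate u * u = 1" using conjugate_mult_self[of u] u by simp
  have cs': "of_real c * of_real c + of_real s * of_real s = (1 :: 'a)"
    using arg_cong[OF cs, of "of_real :: real \<Rightarrow> 'a"] by (simp add: power2_eq_square)
  have ss: "u * (conjugate u * x) = x" for x
    using uu by (metis mult.assoc mult.commute mult_1)
  have "(\<Sum>t\<in>UNIV. conjugate (?Q $ t $ a) * ?Q $ t $ b) = (if a = b then 1 else 0)" for a b
  proof -
    have "(\<Sum>t\<in>- {i, k}. conjugate (?Q $ t $ a) * ?Q $ t $ b)
        = (\<Sum>t\<in>- {i, k}. if t = a then (if a = b then 1 else 0) else 0)"
      by (intro sum.cong refl) (auto simp: plane_rotation_def)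
    also have "\<dots> = (if a = b \<and> a \<noteq> i \<and> a \<noteq> k then 1 else 0)" by simp
    finally have rest: "(\<Sum>t\<in>- {i, k}. conjugate (?Q $ t $ a) * ?Q $ t $ b)
        = (if a = b \<and> a \<noteq> i \<and> a \<noteq> k then 1 else 0)" .
    show ?thesis
      unfolding sum_split_two[OF ik] rest
      using ik cs'
      by (auto simp: ss plane_rotation_def conjugate_dist_mul conjugate_neg mult_ac add.commute)
  qed
  then show "ctranspose ?Q ** ?Q = mat 1"
    by (simp add: vec_eq_iff matrix_matrix_mult_def ctranspose_def mat_def)
qed

lemma inner_plane_rotation:
  fixes B :: "'a::hermitian_field ^ 'p ^ 'p"
  assumes ik: "i \<noteq> k"
  shows "inner (plane_rotation i k c s u) B - inner (mat 1) B
    = (c - 1) * (inner 1 (B $ i $ i) + inner 1 (B $ k $ k))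
      + s * inner u (B $ i $ k - conjugate (B $ k $ i))"
proof -
  let ?D = "plane_rotation i k c s u - mat 1"
  have rest: "(\<Sum>a\<in>- {i, k}. inner (?D $ a) (B $ a)) = 0"
    by (intro sum.neutral ballI) (auto simp: inner_vec_def plane_rotation_def mat_def intro!: sum.neutral)
  have row: "inner (?D $ a) (B $ a) = inner (?D $ a $ i) (B $ a $ i) + inner (?D $ a $ k) (B $ a $ k)"
    if "a = i \<or> a = k" for a
  proof -
    have "(\<Sum>b\<in>- {i, k}. inner (?D $ a $ b) (B $ a $ b)) = 0"
      using that by (intro sum.neutral ballI) (auto simp: plane_rotation_def mat_def)
    then show ?thesis unfolding inner_vec_def[of "?D $ a"] sum_split_two[OF ik] by simp
  qed
  have entries: "?D $ i $ i = (c - 1) *\<^sub>R 1" "?D $ k $ k = (c - 1) *\<^sub>R 1"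
    "?D $ i $ k = s *\<^sub>R u" "?D $ k $ i = - (s *\<^sub>R conjugate u)"
    using ik by (simp_all add: plane_rotation_def mat_def scaleR_conv_of_real)
  have "inner ?D B = inner (?D $ i) (B $ i) + inner (?D $ k) (B $ k)"
    unfolding inner_vec_def[of ?D] sum_split_two[OF ik] rest by simp
  also have "\<dots> = (c - 1) * inner 1 (B $ i $ i) + s * inner u (B $ i $ k)
      - s * inner (conjugate u) (B $ k $ i) + (c - 1) * inner 1 (B $ k $ k)"
    unfolding row[OF disjI1[OF refl]] row[OF disjI2[OF refl]] entries by simp
  also have "inner (conjugate u) (B $ k $ i) = inner u (conjugate (B $ k $ i))"
    using inner_conjugate_conjugate[of u "conjugate (B $ k $ i)"] by simp
  finally show ?thesis by (simp add: inner_diff_left inner_diff_right algebra_simps)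
qed

text \<open>
  The largest value of \<open>c \<alpha> + s \<beta>\<close> on the unit circle is the length of \<open>(\<alpha>, \<beta>)\<close>; if it is attained
  at \<open>(1, 0)\<close>, then \<open>\<beta>\<close> vanishes.
\<close>
lemma rotation_max_imp_zero:
  fixes \<alpha> \<beta> :: real
  assumes "\<And>c s. c\<^sup>2 + s\<^sup>2 = 1 \<Longrightarrow> (c - 1) * \<alpha> + s * \<beta> \<le> 0"
  shows "\<beta> = 0"
proof (rule ccontr)
  assume nz: "\<beta> \<noteq> 0"
  define \<rho> where "\<rho> = sqrt (\<alpha>\<^sup>2 + \<beta>\<^sup>2)"
  have \<rho>2: "\<rho>\<^sup>2 = \<alpha>\<^sup>2 + \<beta>\<^sup>2" by (simp add: \<rho>_def)
  have pos: "0 < \<rho>" unfolding \<rho>_def using nz by (simp add: sum_power2_gt_zero_iff)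
  have "(\<alpha> / \<rho>)\<^sup>2 + (\<beta> / \<rho>)\<^sup>2 = 1"
    using pos by (simp add: power_divide \<rho>2[symmetric] add_divide_distrib[symmetric])
  from assms[OF this] have "\<alpha> / \<rho> * \<alpha> + \<beta> / \<rho> * \<beta> \<le> \<alpha>"
    by (simp add: left_diff_distrib)
  moreover have "\<alpha> / \<rho> * \<alpha> + \<beta> / \<rho> * \<beta> = \<rho>\<^sup>2 / \<rho>"
    unfolding \<rho>2 by (simp add: power2_eq_square add_divide_distrib)
  ultimately have "\<rho> \<le> \<alpha>" using pos by (simp add: power2_eq_square)
  then have "\<rho>\<^sup>2 \<le> \<alpha>\<^sup>2" using pos by (intro power_mono) auto
  then show False using nz by (simp add: \<rho>2)
qed

text \<open>
  Optimality conditions at the identity matrix. Rotations in a coordinate plane, with an arbitrary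
  phase \<open>u\<close>, test an off-diagonal pair of entries; the phase of a diagonal entry, put in its place,
  tests that entry.
\<close>
lemma hermitian_of_inner_max:
  fixes B :: "'a::hermitian_field ^ 'p ^ 'p"
  assumes max: "\<And>Q. unitary_matrix Q \<Longrightarrow> inner Q B \<le> inner (mat 1) B"
  shows "B $ i $ k = conjugate (B $ k $ i)" and "B $ i $ i = of_real (norm (B $ i $ i))"
proof -
  show diag: "B $ i $ i = of_real (norm (B $ i $ i))" for i
  proof (cases "B $ i $ i = 0")
    case False
    define u where "u a = (if a = i then B $ i $ i / of_real (norm (B $ i $ i)) else 1)" for a
    have "norm (u a) = 1" for a using False by (simp add: u_def norm_divide)
    then have "unitary_matrix (\<chi> a b. if b = id a then u a else 0)"
      by (intro unitary_matrix_monomial) auto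
    from max[OF this] have le: "inner (\<chi> a b. if b = a then u a else 0) B \<le> inner (mat 1) B" by simp
    have tr: "inner (\<chi> a b. if b = a then v a else 0) B = (\<Sum>a\<in>UNIV. inner (v a) (B $ a $ a))" for v
    proof -
      have "inner (\<chi> a b. if b = a then v a else 0) B
          = (\<Sum>a\<in>UNIV. \<Sum>b\<in>UNIV. if b = a then inner (v a) (B $ a $ b) else 0)"
        unfolding inner_vec_def by (intro sum.cong refl) auto
      then show ?thesis by simp
    qed
    have "(mat 1 :: 'a ^ 'p ^ 'p) = (\<chi> a b. if b = a then 1 else 0)"
      by (simp add: mat_def vec_eq_iff eq_commute)
    then have "inner (mat 1) B = (\<Sum>a\<in>UNIV. inner 1 (B $ a $ a))"
      by (simp only: tr)
    with le have "(\<Sum>a\<in>UNIV. inner (u a) (B $ a $ a)) \<le> (\<Sum>a\<in>UNIV. inner 1 (B $ a $ a))"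
      by (simp only: tr)
    moreover have "(\<Sum>a\<in>UNIV. inner (v a) (B $ a $ a))
        = inner (v i) (B $ i $ i) + (\<Sum>a\<in>-{i}. inner (v a) (B $ a $ a))" for v
      using sum.remove[of UNIV i] by (simp add: Compl_eq_Diff_UNIV)
    moreover have "(\<Sum>a\<in>-{i}. inner (u a) (B $ a $ a)) = (\<Sum>a\<in>-{i}. inner 1 (B $ a $ a))"
      by (intro sum.cong refl) (simp add: u_def)
    ultimately have "inner (u i) (B $ i $ i) \<le> inner 1 (B $ i $ i)" by simp
    moreover have "u i = (1 / norm (B $ i $ i)) *\<^sub>R B $ i $ i"
      by (simp add: u_def scaleR_conv_of_real divide_inverse mult.commute)
    then have "inner (u i) (B $ i $ i) = norm (B $ i $ i)"
      using False by (simp add: power2_norm_eq_inner[symmetric] power2_eq_square)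
    ultimately show ?thesis by (intro inner_one_of_norm) simp
  qed simp
  show "B $ i $ k = conjugate (B $ k $ i)"
  proof (cases "i = k")
    case True
    then show ?thesis using diag[of k] by (metis conjugate_of_real)
  next
    case ik: False
    define z where "z = B $ i $ k - conjugate (B $ k $ i)"
    have "z = 0"
    proof (rule ccontr)
      assume nz: "z \<noteq> 0"
      define u where "u = (1 / norm z) *\<^sub>R z"
      have u: "norm u = 1" using nz by (simp add: u_def)
      have "(c - 1) * (inner 1 (B $ i $ i) + inner 1 (B $ k $ k)) + s * inner u z \<le> 0"
        if "c\<^sup>2 + s\<^sup>2 = 1" for c s
        using max[OF unitary_plane_rotation[OF ik that u]] inner_plane_rotation[OF ik, of c s u B]
        by (simp add: z_def)
      then have "inner u z = 0" by (rule rotation_max_imp_zero)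
      then show False using nz by (simp add: u_def)
    qed
    then show ?thesis by (simp add: z_def)
  qed
qed

lemma compact_unitary_matrices: "compact {U :: 'a::hermitian_field ^ 'p ^ 'p. unitary_matrix U}"
proof -
  have "norm U \<le> sqrt (real CARD('p))" if "unitary_matrix U" for U :: "'a ^ 'p ^ 'p"
  proof -
    have "norm U = sqrt (\<Sum>i\<in>UNIV. \<Sum>j\<in>UNIV. (norm (U $ i $ j))\<^sup>2)"
      by (simp add: norm_vec_def L2_set_def sum_nonneg)
    then show ?thesis by (simp add: unitary_matrix_row_sum[OF that])
  qed
  then have "bounded {U :: 'a ^ 'p ^ 'p. unitary_matrix U}" by (auto simp: bounded_iff)
  moreover have "closed {U :: 'a ^ 'p ^ 'p. unitary_matrix U}"
  proof -
    have "{U :: 'a ^ 'p ^ 'p. unitary_matrix U} = {U. ctranspose U ** U = mat 1}"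
      using unitary_matrixI unitary_matrix_def by blast
    also have "closed \<dots>"
      unfolding ctranspose_def matrix_matrix_mult_def
      by (intro closed_Collect_eq continuous_intros) 
    finally show ?thesis .
  qed
  ultimately show ?thesis by (simp add: compact_eq_bounded_closed)
qed

text \<open>
  A variational proof. Let \<open>C\<close> be diagonal with positive and pairwise distinct entries \<open>c\<close>, and let
  \<open>(U, V)\<close> maximise the real inner product of \<open>U C V*\<close> and \<open>X\<close> over the compact set of pairs of
  unitary matrices. For \<open>M = U* X V\<close>, optimality in \<open>U\<close> makes \<open>M C*\<close> Hermitian and optimality in
  \<open>V\<close> makes \<open>C* M\<close> Hermitian. An off-diagonal entry \<open>a\<close> of \<open>M\<close> and the conjugate \<open>b\<close> of its mirror
  entry then satisfy \<open>c k a = c i b\<close> and \<open>c i a = c k b\<close>, which forces \<open>a = 0\<close> because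
  \<open>(c i)\<^sup>2 \<noteq> (c k)\<^sup>2\<close>. The diagonal of \<open>M\<close> is real because that of \<open>M C*\<close> is.
\<close>
lemma svd_exists_unsorted:
  fixes X :: "('a::hermitian_field, 'm::{finite,linorder}, 'n::{finite,linorder}) matrix"
  assumes mn: "CARD('m) \<le> CARD('n)"
  obtains U V y where "unitary_matrix U" "unitary_matrix V" "X = U ** diag_rect y ** ctranspose V"
proof -
  \<comment> \<open>The summand 1 keeps the weight of the first index positive.\<close>
  define c :: "'m \<Rightarrow> real" where "c i = real (idx_pos i) + 1" for i
  have c_pos: "0 < c i" for i by (simp add: c_def)
  have c_inj: "c i = c j \<longleftrightarrow> i = j" for i j by (simp add: c_def idx_pos_eq_iff)
  define C :: "('a, 'm, 'n) matrix" where "C = diag_rect (\<chi> i. c i)"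
  define f where "f = (\<lambda>(U, V). inner (U ** C) (X ** V))"
  let ?K = "{U :: ('a, 'm, 'm) matrix. unitary_matrix U} \<times> {V :: ('a, 'n, 'n) matrix. unitary_matrix V}"
  have "compact ?K" by (intro compact_Times compact_unitary_matrices)
  moreover have "?K \<noteq> {}"
  proof -
    have "(mat 1, mat 1) \<in> ?K" by (simp add: unitary_matrix_mat_1)
    then show ?thesis by blast
  qed
  moreover have "continuous_on ?K f"
    unfolding f_def split_beta matrix_matrix_mult_def by (intro continuous_intros)
  ultimately obtain w where w: "w \<in> ?K" "\<And>v. v \<in> ?K \<Longrightarrow> f v \<le> f w"
    using continuous_attains_sup[of ?K f] by blast
  obtain U V where UV: "w = (U, V)" by force
  have U: "unitary_matrix U" and V: "unitary_matrix V" using w UV by auto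
  have max: "inner (U' ** C) (X ** V') \<le> inner (U ** C) (X ** V)"
    if "unitary_matrix U'" "unitary_matrix V'" for U' V'
    using w(2)[of "(U', V')"] that by (simp add: f_def UV)
  define M where "M = ctranspose U ** X ** V"
  have fM: "inner ((U ** A) ** C) (X ** (V ** B)) = inner (A ** C) (M ** B)" for A B
  proof -
    have "inner ((U ** A) ** C) (X ** (V ** B)) = inner (U ** (A ** C)) (X ** (V ** B))"
      by (simp add: matrix_mul_assoc)
    then show ?thesis
      by (simp add: inner_matrix_mult_left M_def ctranspose_matrix_mult matrix_mul_assoc)
  qed
  have M_le: "inner (A ** C) (M ** B) \<le> inner C M" if "unitary_matrix A" "unitary_matrix B" for A B
    using max[of "U ** A" "V ** B"] that U V fM[of A B] fM[of "mat 1" "mat 1"]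
    by (simp add: unitary_matrix_mult)
  have left: "inner Q (M ** ctranspose C) \<le> inner (mat 1) (M ** ctranspose C)"
    if "unitary_matrix Q" for Q
    using M_le[OF that unitary_matrix_mat_1] by (simp add: inner_matrix_mult_right[symmetric])
  have right: "inner Q (ctranspose C ** M) \<le> inner (mat 1) (ctranspose C ** M)"
    if "unitary_matrix Q" for Q
  proof -
    from M_le[OF unitary_matrix_mat_1 unitary_matrix_ctranspose[OF that]]
    have "inner C (M ** ctranspose Q) \<le> inner C M" by simp
    then show ?thesis by (simp add: inner_matrix_mult_right[symmetric] inner_matrix_mult_left[symmetric])
  qed
  let ?c = "col_of :: 'm \<Rightarrow> 'n"
  have MC: "(M ** ctranspose C) $ i $ k = c k *\<^sub>R (M $ i $ ?c k)" for i k
    by (simp add: matrix_matrix_mult_def ctranspose_def C_def diag_rect_nth[OF mn] scaleR_conv_of_real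
        if_distrib[of conjugate] if_distrib[of "\<lambda>z. _ * z"] mult.commute cong: if_cong)
  have CM: "(ctranspose C ** M) $ ?c i $ l = c i *\<^sub>R (M $ i $ l)" for i l
  proof -
    have "conjugate (C $ k $ ?c i) = (if k = i then of_real (c k) else 0)" for k
      by (simp add: C_def diag_rect_nth[OF mn] col_of_eq_iff[OF mn])
    then show ?thesis
      by (simp add: matrix_matrix_mult_def ctranspose_def scaleR_conv_of_real
          if_distrib[of "\<lambda>z. z * _"] cong: if_cong)
  qed
  have CM0: "(ctranspose C ** M) $ k $ l = 0" if "k \<notin> range ?c" for k l
    unfolding matrix_matrix_mult_def ctranspose_def C_def
    using that by (auto simp: diag_rect_nth[OF mn] intro!: sum.neutral)
  note hl = hermitian_of_inner_max[OF left] and hr = hermitian_of_inner_max[OF right]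
  have "M $ i $ l = diag_rect (\<chi> i. norm (M $ i $ ?c i)) $ i $ l" for i l
  proof (cases "l \<in> range ?c")
    case False
    have "c i *\<^sub>R (M $ i $ l) = conjugate ((ctranspose C ** M) $ l $ ?c i)"
      using hr(1)[of "?c i" l] CM by simp
    then have "M $ i $ l = 0" using c_pos[of i] by (simp add: CM0[OF False])
    then show ?thesis using False by (auto simp: diag_rect_nth[OF mn])
  next
    case True
    then obtain k where l: "l = ?c k" by blast
    show ?thesis
    proof (cases "k = i")
      case True
      have "norm (c i *\<^sub>R (M $ i $ ?c i)) = c i * norm (M $ i $ ?c i)"
        using c_pos[of i] by simp
      with hl(2)[of i] have "c i *\<^sub>R (M $ i $ ?c i) = of_real (c i * norm (M $ i $ ?c i))"
        unfolding MC by metis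
      then have "M $ i $ ?c i = of_real (norm (M $ i $ ?c i))"
        using c_pos[of i] by (simp add: scaleR_conv_of_real)
      then show ?thesis using True l by (simp add: diag_rect_nth[OF mn])
    next
      case False
      define a where "a = M $ i $ ?c k"
      define b where "b = conjugate (M $ k $ ?c i)"
      have conj_scale: "conjugate (r *\<^sub>R x) = r *\<^sub>R conjugate x" for r and x :: 'a
        by (simp add: scaleR_conv_of_real conjugate_dist_mul)
      have 1: "c k *\<^sub>R a = c i *\<^sub>R b"
        using hl(1)[of i k] unfolding MC by (simp add: a_def b_def conj_scale)
      have 2: "c i *\<^sub>R a = c k *\<^sub>R b"
        using hr(1)[of "?c i" "?c k"] unfolding CM by (simp add: a_def b_def conj_scale)
      have "(c i * c i) *\<^sub>R a = (c k * c k) *\<^sub>R a"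
        using 1 2 by (metis scaleR_scaleR mult.commute)
      moreover have "c i * c i \<noteq> c k * c k"
        using False c_inj[of i k] c_pos[of i] c_pos[of k] by (auto simp: square_eq_iff)
      ultimately have "a = 0" by simp
      then show ?thesis using False l by (simp add: a_def diag_rect_nth[OF mn] col_of_eq_iff[OF mn])
    qed
  qed
  then have "M = diag_rect (\<chi> i. norm (M $ i $ ?c i))" unfolding vec_eq_iff by blast
  moreover have "U ** M ** ctranspose V = X"
  proof -
    have "U ** M ** ctranspose V = (U ** ctranspose U) ** X ** (V ** ctranspose V)"
      by (simp add: M_def matrix_mul_assoc)
    then show ?thesis using U V by (simp add: unitary_matrix_def)
  qed
  ultimately show ?thesis using that[OF U V] by metis
qed

section \<open>Singular values and the spectral operator\<close>

lemma svd_exists: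
  fixes X :: "('a::hermitian_field, 'm::{finite,linorder}, 'n::{finite,linorder}) matrix"
  assumes mn: "CARD('m) \<le> CARD('n)"
  obtains U V s where "unitary_matrix U" "unitary_matrix V" "sorted_nonneg s"
    "X = U ** diag_rect s ** ctranspose V"
proof -
  obtain U V y where UV: "unitary_matrix U" "unitary_matrix V" "X = U ** diag_rect y ** ctranspose V"
    by (rule svd_exists_unsorted[OF mn])
  obtain Q U' V' where "sorted_nonneg (Q *v y)" "unitary_matrix U'" "unitary_matrix V'"
    "\<And>x. U ** diag_rect x ** ctranspose V = U' ** diag_rect (Q *v x) ** ctranspose V'"
    using obtain_sorted_svd[OF mn UV(1,2), of y] by metis
  then show thesis using that UV(3) by metis
qed

lemma singular_values_eqI:
  fixes U :: "('a::hermitian_field, 'm::{finite,linorder}, 'm) matrix"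
    and V :: "('a, 'n::{finite,linorder}, 'n) matrix"
  assumes mn: "CARD('m) \<le> CARD('n)"
    and unit: "unitary_matrix U" "unitary_matrix V" and s: "sorted_nonneg s"
  shows "singular_values (U ** diag_rect s ** ctranspose V) = s"
proof -
  have "singular_values (U ** diag_rect s ** ctranspose V)
    = (THE t. sorted_nonneg t \<and> (\<exists>U' V'. unitary_matrix U' \<and> unitary_matrix V' \<and>
      U ** diag_rect s ** ctranspose V = U' ** diag_rect t ** ctranspose V'))"
    unfolding singular_values_def sorted_nonneg_def by (simp only: conj_assoc)
  also have "\<dots> = s"
  proof (rule the_equality)
    show "sorted_nonneg s \<and> (\<exists>U' V'. unitary_matrix U' \<and> unitary_matrix V' \<and>
        U ** diag_rect s ** ctranspose V = U' ** diag_rect s ** ctranspose V')"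
      using unit s by blast
  next
    fix t assume t: "sorted_nonneg t \<and> (\<exists>U' V'. unitary_matrix U' \<and> unitary_matrix V' \<and>
        U ** diag_rect s ** ctranspose V = U' ** diag_rect t ** ctranspose V')"
    then obtain U' :: "('a, 'm, 'm) matrix" and V' :: "('a, 'n, 'n) matrix"
      where "unitary_matrix U'" "unitary_matrix V'"
        and eq: "U ** diag_rect s ** ctranspose V = U' ** diag_rect t ** ctranspose V'" by blast
    then have "(t $ k - s $ k)\<^sup>2 \<le> 0" for k
      using svd_sorted_diff_le[OF mn, of U' U V' V t s k] unit s t by simp
    then show "t = s" by (simp add: vec_eq_iff)
  qed
  finally show ?thesis .
qed

lemma singular_values_svd:
  fixes X :: "('a::hermitian_field, 'm::{finite,linorder}, 'n::{finite,linorder}) matrix"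
  assumes mn: "CARD('m) \<le> CARD('n)"
  shows "sorted_nonneg (singular_values X)" and "svd_pairs X \<noteq> {}"
proof -
  obtain U V s where "unitary_matrix U" "unitary_matrix V" "sorted_nonneg s"
    "X = U ** diag_rect s ** ctranspose V"
    by (rule svd_exists[OF mn])
  moreover from this have "singular_values X = s" using singular_values_eqI[OF mn] by blast
  ultimately have "sorted_nonneg (singular_values X) \<and> (U, V) \<in> svd_pairs X"
    by (simp add: svd_pairs_def)
  then show "sorted_nonneg (singular_values X)" "svd_pairs X \<noteq> {}" by auto
qed

lemma spectral_operator_svd:
  fixes X :: "('a::hermitian_field, 'm::{finite,linorder}, 'n::{finite,linorder}) matrix"
  assumes mn: "CARD('m) \<le> CARD('n)"
  obtains U V where "unitary_matrix U" "unitary_matrix V"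
    "X = U ** diag_rect (singular_values X) ** ctranspose V"
    "spectral_operator g X = U ** diag_rect (g (singular_values X)) ** ctranspose V"
proof -
  obtain U V where UV: "(SOME p. p \<in> svd_pairs X) = (U, V)" by force
  then have "(U, V) \<in> svd_pairs X"
    using singular_values_svd(2)[OF mn, of X] by (metis some_in_eq)
  moreover have "spectral_operator g X = U ** diag_rect (g (singular_values X)) ** ctranspose V"
    by (simp add: spectral_operator_def UV)
  ultimately show thesis using that[of U V] by (simp add: svd_pairs_def)
qed

lemma norm_singular_values_diff_le:
  fixes X Y :: "('a::hermitian_field, 'm::{finite,linorder}, 'n::{finite,linorder}) matrix"
  assumes mn: "CARD('m) \<le> CARD('n)"
  shows "norm (singular_values X - singular_values Y) \<le> 2 * real CARD('m) * norm (X - Y)"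
proof -
  obtain U V where U: "unitary_matrix U" "unitary_matrix V"
    "X = U ** diag_rect (singular_values X) ** ctranspose V"
    by (rule spectral_operator_svd[OF mn, of X])
  obtain U' V' where U': "unitary_matrix U'" "unitary_matrix V'"
    "Y = U' ** diag_rect (singular_values Y) ** ctranspose V'"
    by (rule spectral_operator_svd[OF mn, of Y])
  have "\<bar>singular_values X $ k - singular_values Y $ k\<bar> \<le> 2 * norm (X - Y)" for k
  proof (rule power2_le_imp_le)
    have "(singular_values X $ k - singular_values Y $ k)\<^sup>2 \<le> 2 * (norm (X - Y))\<^sup>2"
      using svd_sorted_diff_le[OF mn U(1) U'(1) U(2) U'(2) singular_values_svd(1)[OF mn, of X]
          singular_values_svd(1)[OF mn, of Y], of k]
      by (simp flip: U(3) U'(3))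
    also have "\<dots> \<le> (2 * norm (X - Y))\<^sup>2" by (simp add: power_mult_distrib)
    finally show "\<bar>singular_values X $ k - singular_values Y $ k\<bar>\<^sup>2 \<le> (2 * norm (X - Y))\<^sup>2" by simp
  qed simp
  then have "(\<Sum>k\<in>UNIV. \<bar>(singular_values X - singular_values Y) $ k\<bar>)
      \<le> (\<Sum>k\<in>(UNIV :: 'm set). 2 * norm (X - Y))"
    by (intro sum_mono) simp
  then show ?thesis using norm_le_l1_cart[of "singular_values X - singular_values Y"] by simp
qed

section \<open>Absolutely symmetric maps in coordinates\<close>

text \<open>
  For a sign \<open>e\<close>, it fixes \<open>x\<close> exactly when \<open>x $ i = e * x $ j\<close>; for \<open>i = j\<close> it is the
  multiplication of one coordinate by \<open>e\<close>. Through it, absolute symmetry of \<open>g\<close> becomes a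
  statement about pairs of coordinates.
\<close>
definition signed_swap :: "real \<Rightarrow> 'm \<Rightarrow> 'm \<Rightarrow> real ^ 'm ^ 'm" where
  "signed_swap e i j = signed_perm (\<lambda>k. if k = i \<or> k = j then e else 1)
     (\<lambda>k. if k = i then j else if k = j then i else k)"

lemma signed_swap_mult_nth:
  "(signed_swap e i j *v x) $ k = (if k = i then e * x $ j else if k = j then e * x $ i else x $ k)"
  by (simp add: signed_swap_def signed_perm_mult_nth)

lemma bij_swap: "bij (\<lambda>k. if k = i then j else if k = j then i else k)"
  by (rule involuntory_imp_bij) auto

lemma signed_permutation_matrix_signed_swap:
  "e = 1 \<or> e = -1 \<Longrightarrow> signed_permutation_matrix (signed_swap e i j)"
  unfolding signed_swap_def by (rule signed_permutation_matrix_signed_perm[OF bij_swap]) auto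

lemma norm_signed_swap:
  fixes x :: "real ^ 'm"
  assumes "e = 1 \<or> e = -1"
  shows "norm (signed_swap e i j *v x) = norm x"
proof -
  let ?\<pi> = "\<lambda>k. if k = i then j else if k = j then i else k"
  have "((signed_swap e i j *v x) $ k)\<^sup>2 = (x $ ?\<pi> k)\<^sup>2" for k
    using assms by (auto simp: signed_swap_mult_nth)
  then have "(norm (signed_swap e i j *v x))\<^sup>2 = (\<Sum>k\<in>UNIV. (x $ ?\<pi> k)\<^sup>2)"
    by (simp add: norm_vec_power2)
  also have "\<dots> = (norm x)\<^sup>2"
    unfolding norm_vec_power2 by (rule sum.reindex_bij_betw[OF bij_swap])
  finally show ?thesis by simp
qed

lemma signed_swap_fixed:
  "e = 1 \<or> e = -1 \<Longrightarrow> x $ i = e * x $ j \<Longrightarrow> signed_swap e i j *v x = x"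
  by (auto simp: vec_eq_iff signed_swap_mult_nth)

lemma norm_diff_signed_swap_le:
  fixes x :: "real ^ 'm"
  assumes "e = 1 \<or> e = -1"
  shows "norm (x - signed_swap e i j *v x) \<le> 2 * \<bar>x $ i - e * x $ j\<bar>"
proof -
  let ?y = "x - signed_swap e i j *v x"
  have "(\<Sum>k\<in>UNIV. \<bar>?y $ k\<bar>) = (\<Sum>k\<in>{i, j}. \<bar>?y $ k\<bar>)"
    by (rule sum.mono_neutral_right) (auto simp: signed_swap_mult_nth)
  also have "\<dots> \<le> real (card {i, j}) * \<bar>x $ i - e * x $ j\<bar>"
    using assms by (intro sum_bounded_above) (auto simp: signed_swap_mult_nth)
  also have "\<dots> \<le> 2 * \<bar>x $ i - e * x $ j\<bar>"
    by (intro mult_right_mono) (auto simp: card_insert_if)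
  finally show ?thesis using norm_le_l1_cart[of ?y] by linarith
qed

lemma absolutely_symmetric_coords:
  assumes "absolutely_symmetric_on D g" "x \<in> D" "e = 1 \<or> e = -1" "x $ i = e * x $ j"
  shows "g x $ i = e * g x $ j"
proof -
  have "g x = signed_swap e i j *v g x"
    using assms signed_permutation_matrix_signed_swap signed_swap_fixed
    unfolding absolutely_symmetric_on_def by metis
  then show ?thesis by (metis signed_swap_mult_nth)
qed

lemma absolutely_symmetric_coord_zero:
  assumes "absolutely_symmetric_on D g" "x \<in> D" "x $ i = 0"
  shows "g x $ i = 0"
  using absolutely_symmetric_coords[OF assms(1,2), of "-1" i i] assms(3) by simp

text \<open>
  The link from a Lipschitz bound on the vector \<open>g x\<close> to bounds on pairs of its coordinates. If
  \<open>\<sigma> $ i = e * \<sigma> $ j\<close>, the signed swap \<open>Q\<close> of the two coordinates fixes \<open>\<sigma>\<close>, hence keeps balls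
  around \<open>\<sigma>\<close> invariant, and the Lipschitz bound for the points \<open>y\<close> and \<open>Q y\<close> controls
  \<open>g y $ i - e * g y $ j\<close> by \<open>y $ i - e * y $ j\<close>. Otherwise \<open>x $ i - e * y $ j\<close> is bounded away from
  zero near \<open>\<sigma>\<close>, and boundedness of \<open>g\<close> suffices.
\<close>
lemma locally_lipschitz_coords:
  fixes g :: "real ^ 'm \<Rightarrow> real ^ 'm"
  assumes sym: "absolutely_symmetric_on D g" and D: "open D" "\<sigma> \<in> D"
    and lip: "locally_lipschitz_near UNIV g \<sigma>"
  shows "\<exists>\<epsilon>>0. \<exists>K. \<forall>x\<in>ball \<sigma> \<epsilon>. \<forall>y\<in>ball \<sigma> \<epsilon>. \<forall>i j e. e = 1 \<or> e = -1 \<longrightarrow>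
    \<bar>g x $ i - e * g y $ j\<bar> \<le> K * (norm (x - y) + \<bar>x $ i - e * y $ j\<bar>)"
proof -
  obtain W L where W: "open W" "\<sigma> \<in> W" "L-lipschitz_on W g"
    using lip unfolding locally_lipschitz_near_def by blast
  obtain \<epsilon>\<^sub>1 where \<epsilon>\<^sub>1: "0 < \<epsilon>\<^sub>1" "ball \<sigma> \<epsilon>\<^sub>1 \<subseteq> W \<inter> D"
    using open_Int[OF W(1) D(1)] W(2) D(2) by (meson IntI open_contains_ball)
  \<comment> \<open>The least positive gap between coordinates up to sign; 1 makes the set nonempty.\<close>
  define A where "A = insert 1 ((\<lambda>(i, j, e). \<bar>\<sigma> $ i - e * \<sigma> $ j\<bar>) ` (UNIV \<times> UNIV \<times> {1, -1}) - {0})"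
  define \<delta> where "\<delta> = Min A"
  have A: "finite A" "A \<noteq> {}" "\<And>a. a \<in> A \<Longrightarrow> 0 < a" by (auto simp: A_def)
  have \<delta>0: "0 < \<delta>" using A by (simp add: \<delta>_def)
  have \<delta>: "\<delta> \<le> \<bar>\<sigma> $ i - e * \<sigma> $ j\<bar>" if "e = 1 \<or> e = -1" "\<sigma> $ i \<noteq> e * \<sigma> $ j" for i j e
  proof -
    have "\<bar>\<sigma> $ i - e * \<sigma> $ j\<bar> \<in> A"
      unfolding A_def using that by (intro insertI2 DiffI image_eqI[of _ _ "(i, j, e)"]) auto
    then show ?thesis unfolding \<delta>_def by (rule Min_le[OF A(1)])
  qed
  \<comment> \<open>Moving both points by at most \<open>\<delta> / 4\<close> leaves half of the gap.\<close>
  define \<epsilon> where "\<epsilon> = min \<epsilon>\<^sub>1 (\<delta> / 4)"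
  have \<epsilon>: "0 < \<epsilon>" "\<epsilon> \<le> \<epsilon>\<^sub>1" "\<epsilon> \<le> \<delta> / 4" using \<epsilon>\<^sub>1 \<delta>0 by (auto simp: \<epsilon>_def)
  have sub: "ball \<sigma> \<epsilon> \<subseteq> W" "ball \<sigma> \<epsilon> \<subseteq> D"
    using \<epsilon>\<^sub>1(2) subset_ball[OF \<epsilon>(2)] by blast+
  have L0: "0 \<le> L" using W(3) by (rule lipschitz_on_nonneg)
  have gL: "norm (g x - g y) \<le> L * norm (x - y)" if "x \<in> ball \<sigma> \<epsilon>" "y \<in> ball \<sigma> \<epsilon>" for x y
  proof -
    have "x \<in> W" "y \<in> W" using that sub(1) by blast+
    from lipschitz_onD[OF W(3) this] show ?thesis by (simp add: dist_norm)
  qed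
  define M where "M = norm (g \<sigma>) + L * \<epsilon>"
  have M0: "0 \<le> M" using L0 \<epsilon>(1) by (simp add: M_def)
  have gM: "norm (g x) \<le> M" if "x \<in> ball \<sigma> \<epsilon>" for x
  proof -
    have "norm (g x) \<le> norm (g \<sigma>) + norm (g x - g \<sigma>)" by (rule norm_triangle_sub)
    also have "norm (g x - g \<sigma>) \<le> L * norm (x - \<sigma>)" using gL that \<epsilon>(1) by simp
    also have "\<dots> \<le> L * \<epsilon>"
      using that L0 by (intro mult_left_mono) (auto simp: dist_norm norm_minus_commute)
    finally show ?thesis by (simp add: M_def)
  qed
  \<comment> \<open>\<open>3 * L\<close> serves coordinates with no gap at \<open>\<sigma>\<close>, \<open>4 * M / \<delta>\<close> those with a gap.\<close>
  define K where "K = 3 * L + 4 * M / \<delta>"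
  have K: "0 \<le> K" "3 * L \<le> K" "4 * M / \<delta> \<le> K" using L0 M0 \<delta>0 by (simp_all add: K_def)
  have "\<bar>g x $ i - e * g y $ j\<bar> \<le> K * (norm (x - y) + \<bar>x $ i - e * y $ j\<bar>)"
    if x: "x \<in> ball \<sigma> \<epsilon>" and y: "y \<in> ball \<sigma> \<epsilon>" and e: "e = 1 \<or> e = -1" for x y i j e
  proof (cases "\<sigma> $ i = e * \<sigma> $ j")
    case True
    let ?Q = "signed_swap e i j"
    have "norm (?Q *v y - \<sigma>) = norm (y - \<sigma>)"
      using signed_swap_fixed[OF e True] norm_signed_swap[OF e, of i j "y - \<sigma>"]
      by (simp add: matrix_vector_mult_diff_distrib)
    then have Qy: "?Q *v y \<in> ball \<sigma> \<epsilon>" using y by (simp add: dist_norm norm_minus_commute)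
    have gQ: "g (?Q *v y) = ?Q *v g y"
      using sym y sub(2) signed_permutation_matrix_signed_swap[OF e]
      unfolding absolutely_symmetric_on_def by blast
    have "\<bar>g y $ i - e * g y $ j\<bar> = \<bar>(g y - g (?Q *v y)) $ i\<bar>"
      by (simp add: gQ signed_swap_mult_nth)
    also have "\<dots> \<le> norm (g y - g (?Q *v y))" by (rule component_le_norm_cart)
    also have "\<dots> \<le> L * norm (y - ?Q *v y)" by (rule gL[OF y Qy])
    also have "\<dots> \<le> L * (2 * \<bar>y $ i - e * y $ j\<bar>)"
      by (intro mult_left_mono norm_diff_signed_swap_le[OF e] L0)
    also have "\<dots> \<le> L * (2 * (norm (x - y) + \<bar>x $ i - e * y $ j\<bar>))"
      using component_le_norm_cart[of "x - y" i] by (intro mult_left_mono L0) auto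
    finally have 1: "\<bar>g y $ i - e * g y $ j\<bar> \<le> 2 * (L * (norm (x - y) + \<bar>x $ i - e * y $ j\<bar>))"
      by (simp add: algebra_simps)
    have "\<bar>g x $ i - g y $ i\<bar> \<le> norm (g x - g y)"
      using component_le_norm_cart[of "g x - g y" i] by simp
    also have "\<dots> \<le> L * norm (x - y)" by (rule gL[OF x y])
    also have "\<dots> \<le> L * (norm (x - y) + \<bar>x $ i - e * y $ j\<bar>)" by (intro mult_left_mono L0) auto
    finally have "\<bar>g x $ i - e * g y $ j\<bar> \<le> 3 * L * (norm (x - y) + \<bar>x $ i - e * y $ j\<bar>)"
      using 1 by linarith
    also have "\<dots> \<le> K * (norm (x - y) + \<bar>x $ i - e * y $ j\<bar>)"
      by (intro mult_right_mono K) auto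
    finally show ?thesis .
  next
    case False
    have e1: "\<bar>e\<bar> = 1" using e by auto
    have xy: "\<bar>x $ i - \<sigma> $ i\<bar> \<le> \<epsilon>" "\<bar>y $ j - \<sigma> $ j\<bar> \<le> \<epsilon>"
      using component_le_norm_cart[of "x - \<sigma>" i] component_le_norm_cart[of "y - \<sigma>" j] x y
      by (auto simp: dist_norm norm_minus_commute)
    have "\<sigma> $ i - e * \<sigma> $ j = (x $ i - e * y $ j) - (x $ i - \<sigma> $ i) + e * (y $ j - \<sigma> $ j)"
      by (simp add: algebra_simps)
    also have "\<bar>\<dots>\<bar> \<le> \<bar>x $ i - e * y $ j\<bar> + \<bar>x $ i - \<sigma> $ i\<bar> + \<bar>e * (y $ j - \<sigma> $ j)\<bar>"
      by linarith
    also have "\<bar>e * (y $ j - \<sigma> $ j)\<bar> = \<bar>y $ j - \<sigma> $ j\<bar>" by (simp add: abs_mult e1)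
    finally have "\<delta> / 2 \<le> \<bar>x $ i - e * y $ j\<bar>"
      using \<delta>[OF e False] \<epsilon>(3) xy by linarith
    then have ge: "1 \<le> 2 / \<delta> * \<bar>x $ i - e * y $ j\<bar>" using \<delta>0 by (simp add: field_simps)
    have "\<bar>g x $ i\<bar> \<le> M" "\<bar>g y $ j\<bar> \<le> M"
      using component_le_norm_cart[of "g x" i] component_le_norm_cart[of "g y" j] gM[OF x] gM[OF y]
      by linarith+
    then have "\<bar>g x $ i - e * g y $ j\<bar> \<le> 2 * M * 1" using e by auto
    also have "\<dots> \<le> 2 * M * (2 / \<delta> * \<bar>x $ i - e * y $ j\<bar>)"
      using ge M0 by (intro mult_left_mono) auto
    also have "\<dots> = 4 * M / \<delta> * \<bar>x $ i - e * y $ j\<bar>" by simp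
    also have "\<dots> \<le> K * (norm (x - y) + \<bar>x $ i - e * y $ j\<bar>)"
      by (intro mult_mono K) auto
    finally show ?thesis .
  qed
  then show ?thesis using \<epsilon>(1) by blast
qed

section \<open>Local Lipschitz continuity\<close>

text \<open>
  The operator can be evaluated in any diagonal form, sorted or not. Rearranging \<open>y\<close> to its sorted
  absolute values changes \<open>g y\<close> in the same way, by absolute symmetry; and two decompositions
  of one matrix with the same sorted diagonal have coupling value zero, which \<open>transfer_eq_0\<close> passes on to \<open>g\<close>.
\<close>
lemma spectral_operator_diag:
  fixes U :: "('a::hermitian_field, 'm::{finite,linorder}, 'm) matrix"
    and V :: "('a, 'n::{finite,linorder}, 'n) matrix"
  assumes mn: "CARD('m) \<le> CARD('n)" and sym: "absolutely_symmetric_on D g"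
    and unit: "unitary_matrix U" "unitary_matrix V" and y: "y \<in> D"
    and sv: "singular_values (U ** diag_rect y ** ctranspose V) \<in> D"
  shows "spectral_operator g (U ** diag_rect y ** ctranspose V) = U ** diag_rect (g y) ** ctranspose V"
proof -
  let ?Y = "U ** diag_rect y ** ctranspose V"
  obtain Q U\<^sub>1 V\<^sub>1 where Q: "signed_permutation_matrix Q" "sorted_nonneg (Q *v y)"
    and UV1: "unitary_matrix U\<^sub>1" "unitary_matrix V\<^sub>1"
    and eq1: "\<And>x. U ** diag_rect x ** ctranspose V = U\<^sub>1 ** diag_rect (Q *v x) ** ctranspose V\<^sub>1"
    using obtain_sorted_svd[OF mn unit, of y] by metis
  have s: "singular_values ?Y = Q *v y"
    unfolding eq1 by (rule singular_values_eqI[OF mn UV1 Q(2)])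
  have gs: "g (Q *v y) = Q *v g y" using sym y Q(1) by (simp add: absolutely_symmetric_on_def)
  obtain U\<^sub>2 V\<^sub>2 where UV2: "unitary_matrix U\<^sub>2" "unitary_matrix V\<^sub>2"
    and eq2: "?Y = U\<^sub>2 ** diag_rect (singular_values ?Y) ** ctranspose V\<^sub>2"
    and G: "spectral_operator g ?Y = U\<^sub>2 ** diag_rect (g (singular_values ?Y)) ** ctranspose V\<^sub>2"
    by (rule spectral_operator_svd[OF mn, of ?Y])
  let ?F = "\<lambda>a b. (norm (U\<^sub>1 ** diag_rect a ** ctranspose V\<^sub>1 - U\<^sub>2 ** diag_rect b ** ctranspose V\<^sub>2))\<^sup>2"
  obtain p q d r t where coupling: "svd_coupling ?F p q d r t"
    by (rule obtain_svd_coupling[OF mn UV1(1) UV2(1) UV1(2) UV2(2)])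
  have sD: "Q *v y \<in> D" using sv s by simp
  have "?F (Q *v y) (Q *v y) = 0" using eq1[of y] eq2 s by simp
  then have "?F (g (Q *v y)) (g (Q *v y)) = 0"
    by (rule svd_coupling.transfer_eq_0[OF coupling])
      (use absolutely_symmetric_coords[OF sym sD] absolutely_symmetric_coord_zero[OF sym sD] in auto)
  then show ?thesis using G s gs eq1[of "g y"] by simp
qed

text \<open>
  For fixed unitary factors, \<open>y \<mapsto> U [Diag y 0] V*\<close> is an isometric embedding that conjugates \<open>g\<close>
  to the spectral operator, so a Lipschitz bound restricts to \<open>g\<close>. Conversely
  \<open>locally_lipschitz_coords\<close> supplies the hypotheses of \<open>transfer_le\<close>, with the distance of the
  singular value vectors as the error \<open>\<delta>\<close>, and that distance is itself bounded by the distance of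
  the matrices.
\<close>
theorem spectral_operator_locally_lipschitz_iff:
  fixes g :: "(real, 'm::{finite,linorder}) vec \<Rightarrow> (real, 'm) vec"
    and X :: "('a::hermitian_field, 'm, 'n::{finite,linorder}) matrix"
  assumes mn: "CARD('m) \<le> CARD('n)" and D: "open D" and sym: "absolutely_symmetric_on D g"
    and N: "open N" "singular_values ` N \<subseteq> D" "X \<in> N"
  shows "locally_lipschitz_near N (spectral_operator g) X
    \<longleftrightarrow> locally_lipschitz_near UNIV g (singular_values X)"
proof
  assume "locally_lipschitz_near N (spectral_operator g) X"
  then obtain W L where W: "open W" "X \<in> W" "W \<subseteq> N" "L-lipschitz_on W (spectral_operator g)"
    unfolding locally_lipschitz_near_def by blast
  let ?\<sigma> = "singular_values X"
  obtain U V where UV: "unitary_matrix U" "unitary_matrix V"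
    "X = U ** diag_rect ?\<sigma> ** ctranspose V"
    by (rule spectral_operator_svd[OF mn, of X])
  let ?Y = "\<lambda>y. U ** diag_rect y ** ctranspose V"
  have dist: "dist (?Y y) (?Y z) = dist y z" for y z
  proof -
    have "?Y y - ?Y z = U ** diag_rect (y - z) ** ctranspose V"
      by (simp add: matrix_mult_diff_left matrix_mult_diff_right flip: diag_rect_diff)
    then show ?thesis by (simp add: dist_norm norm_unitary_matrix[OF UV(1,2)] norm_diag_rect[OF mn])
  qed
  obtain \<epsilon>\<^sub>1 where \<epsilon>\<^sub>1: "0 < \<epsilon>\<^sub>1" "ball X \<epsilon>\<^sub>1 \<subseteq> W" using W open_contains_ball by blast
  have "?\<sigma> \<in> D" using N by blast
  then obtain \<epsilon>\<^sub>2 where \<epsilon>\<^sub>2: "0 < \<epsilon>\<^sub>2" "ball ?\<sigma> \<epsilon>\<^sub>2 \<subseteq> D" using D open_contains_ball by blast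
  let ?B = "ball ?\<sigma> (min \<epsilon>\<^sub>1 \<epsilon>\<^sub>2)"
  have inW: "?Y y \<in> W" if "y \<in> ?B" for y
  proof -
    have "dist X (?Y y) = dist ?\<sigma> y" using dist[of ?\<sigma> y] by (simp flip: UV(3))
    then show ?thesis using that \<epsilon>\<^sub>1(2) by auto
  qed
  have G: "spectral_operator g (?Y y) = ?Y (g y)" if "y \<in> ?B" for y
  proof (rule spectral_operator_diag[OF mn sym UV(1,2)])
    show "y \<in> D" using that \<epsilon>\<^sub>2 by auto
    show "singular_values (?Y y) \<in> D" using inW[OF that] W(3) N(2) by blast
  qed
  have "L-lipschitz_on ?B g"
  proof (rule lipschitz_onI)
    show "0 \<le> L" using W(4) by (rule lipschitz_on_nonneg)
    fix y z assume y: "y \<in> ?B" and z: "z \<in> ?B"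
    have "dist (g y) (g z) = dist (spectral_operator g (?Y y)) (spectral_operator g (?Y z))"
      unfolding G[OF y] G[OF z] by (simp only: dist)
    also have "\<dots> \<le> L * dist (?Y y) (?Y z)"
      by (rule lipschitz_onD[OF W(4) inW[OF y] inW[OF z]])
    finally show "dist (g y) (g z) \<le> L * dist y z" by (simp only: dist)
  qed
  moreover have "?\<sigma> \<in> ?B" using \<epsilon>\<^sub>1(1) \<epsilon>\<^sub>2(1) by simp
  ultimately show "locally_lipschitz_near UNIV g ?\<sigma>"
    unfolding locally_lipschitz_near_def by (intro exI[of _ ?B] exI[of _ L]) auto
next
  assume lip: "locally_lipschitz_near UNIV g (singular_values X)"
  let ?\<sigma> = "singular_values :: ('a, 'm, 'n) matrix \<Rightarrow> (real, 'm) vec" and ?m = "real CARD('m)"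
  have \<sigma>D: "?\<sigma> X \<in> D" using N by blast
  obtain \<epsilon> K where \<epsilon>: "0 < \<epsilon>"
    and coords: "\<And>x y i j e. \<lbrakk>x \<in> ball (?\<sigma> X) \<epsilon>; y \<in> ball (?\<sigma> X) \<epsilon>; e = 1 \<or> e = -1\<rbrakk>
       \<Longrightarrow> \<bar>g x $ i - e * g y $ j\<bar> \<le> K * (norm (x - y) + \<bar>x $ i - e * y $ j\<bar>)"
    using locally_lipschitz_coords[OF sym D \<sigma>D lip] by blast
  \<comment> \<open>Taking \<open>x = y\<close>, \<open>i = j\<close> and \<open>e = -1\<close> doubles a single coordinate on both sides.\<close>
  have coord: "\<bar>g x $ i\<bar> \<le> K * \<bar>x $ i\<bar>" if "x \<in> ball (?\<sigma> X) \<epsilon>" for x i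
    using coords[OF that that, of "-1" i i] by simp
  define W where "W = N \<inter> ball X (\<epsilon> / (2 * ?m))"
  have W: "open W" "X \<in> W" "W \<subseteq> N" using N \<epsilon> by (auto simp: W_def)
  have near: "?\<sigma> Y \<in> ball (?\<sigma> X) \<epsilon>" if "Y \<in> W" for Y
  proof -
    have "norm (?\<sigma> X - ?\<sigma> Y) \<le> 2 * ?m * norm (X - Y)" by (rule norm_singular_values_diff_le[OF mn])
    also have "\<dots> < 2 * ?m * (\<epsilon> / (2 * ?m))"
      using that by (intro mult_strict_left_mono) (auto simp: W_def dist_norm)
    finally show ?thesis by (simp add: dist_norm)
  qed
  \<comment> \<open>The cube is \<open>?m * (2 * ?m)\<^sup>2\<close>: total weight times the squared Lipschitz constant of \<open>?\<sigma>\<close>.\<close>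
  define L where "L = sqrt (2 * K\<^sup>2 * (1 + 4 * ?m ^ 3))"
  have L2: "L\<^sup>2 = 2 * K\<^sup>2 * (1 + 4 * ?m ^ 3)" by (simp add: L_def)
  have "L-lipschitz_on W (spectral_operator g)"
  proof (rule lipschitz_onI)
    show "0 \<le> L" by (simp add: L_def)
    fix Y Z assume Y: "Y \<in> W" and Z: "Z \<in> W"
    obtain U V where UV: "unitary_matrix U" "unitary_matrix V"
      "Y = U ** diag_rect (?\<sigma> Y) ** ctranspose V"
      "spectral_operator g Y = U ** diag_rect (g (?\<sigma> Y)) ** ctranspose V"
      by (rule spectral_operator_svd[OF mn, of Y])
    obtain U' V' where UV': "unitary_matrix U'" "unitary_matrix V'"
      "Z = U' ** diag_rect (?\<sigma> Z) ** ctranspose V'"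
      "spectral_operator g Z = U' ** diag_rect (g (?\<sigma> Z)) ** ctranspose V'"
      by (rule spectral_operator_svd[OF mn, of Z])
    let ?F = "\<lambda>a b. (norm (U ** diag_rect a ** ctranspose V - U' ** diag_rect b ** ctranspose V'))\<^sup>2"
    obtain p q d r t where coupling: "svd_coupling ?F p q d r t"
      by (rule obtain_svd_coupling[OF mn UV(1) UV'(1) UV(2) UV'(2)])
    let ?\<delta> = "norm (?\<sigma> Y - ?\<sigma> Z)"
    have "?F (g (?\<sigma> Y)) (g (?\<sigma> Z)) \<le> 2 * K\<^sup>2 * (?F (?\<sigma> Y) (?\<sigma> Z) + ?m * ?\<delta>\<^sup>2)"
      by (rule svd_coupling.transfer_le[OF coupling])
        (intro coords coord near Y Z; assumption)+
    then have "(norm (spectral_operator g Y - spectral_operator g Z))\<^sup>2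
        \<le> 2 * K\<^sup>2 * ((norm (Y - Z))\<^sup>2 + ?m * ?\<delta>\<^sup>2)"
      by (simp flip: UV(3,4) UV'(3,4))
    also have "\<dots> \<le> 2 * K\<^sup>2 * ((norm (Y - Z))\<^sup>2 + ?m * (2 * ?m * norm (Y - Z))\<^sup>2)"
      by (intro mult_left_mono add_left_mono power_mono norm_singular_values_diff_le[OF mn]) auto
    also have "\<dots> = (L * norm (Y - Z))\<^sup>2"
      unfolding power_mult_distrib[of L] L2
      by (simp add: power2_eq_square power3_eq_cube algebra_simps)
    finally have "norm (spectral_operator g Y - spectral_operator g Z) \<le> L * norm (Y - Z)"
      by (rule power2_le_imp_le) (simp add: L_def)
    then show "dist (spectral_operator g Y) (spectral_operator g Z) \<le> L * dist Y Z"
      by (simp add: dist_norm)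
  qed
  then show "locally_lipschitz_near N (spectral_operator g) X"
    unfolding locally_lipschitz_near_def using W by blast
qed

theorem theorem4p1:
  fixes g :: "(real, 'm::{finite,linorder}) vec \<Rightarrow> (real, 'm) vec"
    and D :: "(real, 'm) vec set"
  assumes "CARD('m) \<le> CARD('n::{finite,linorder})"
    and "open D"
    and "absolutely_symmetric_on D g"
  shows
    "(\<forall>(N :: (real, 'm, 'n) matrix set) X.
        open N \<and> N \<noteq> {} \<and> singular_values ` N \<subseteq> D \<and> X \<in> N \<longrightarrow>
        (locally_lipschitz_near N (spectral_operator g) X \<longleftrightarrow>
         locally_lipschitz_near UNIV g (singular_values X))) \<and>
     (\<forall>(N :: (complex, 'm, 'n) matrix set) X.
        open N \<and> N \<noteq> {} \<and> singular_values ` N \<subseteq> D \<and> X \<in> N \<longrightarrow>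
        (locally_lipschitz_near N (spectral_operator g) X \<longleftrightarrow>
         locally_lipschitz_near UNIV g (singular_values X)))"
  by (intro conjI allI impI; elim conjE; rule spectral_operator_locally_lipschitz_iff[OF assms]; assumption)

end
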